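(* Let $\ell\in\mathbb{N}$ and let $\varphi:\mathbb{N}\to[3,\infty)$. Let \[ \mathcal{E}'_{\ell}(\varphi):=\{x\in[0,1): a_n'(x)\cdots a_{n+\ell-1}'(x)\geq \varphi(n)\text{ for infinitely many } n\in\mathbb{N}\}. \] Then the Lebesgue measure of $\mathcal{E}'_{\ell}(\varphi)$ is $0$ if $\displaystyle\sum_{n\geq 1}\frac{(\log\log\varphi(n))^{\ell-1}}{\varphi(n)\log\varphi(n)}<\infty$, and is $1$ if this series diverges.
   Context: For irrational $x\in(0,1)$ with continued fraction expansion $x=[a_1(x),a_2(x),\dots]=\cfrac{1}{a_1(x)+\cfrac{1}{a_2(x)+\cdots}}$, the $a_n(x)\in\mathbb{N}$ are its partial quotients. Define $a_n'(x)=a_n(x)$ if $a_n(x)$ is a prime number, and $a_n'(x)=0$ otherwise. *)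

theory Defs
  imports "HOL-Analysis.Analysis" "HOL-Computational_Algebra.Primes"
begin

text \<open>Gauss map T x = frac(1/x) (with T 0 = 0 by the convention 1/0 = 0).\<close>
definition gauss_map :: "real \<Rightarrow> real" where
  "gauss_map x = frac (1 / x)"

text \<open>n-th partial quotient (n \<ge> 1): a_n(x) = floor(1 / T^(n-1) x).
  For irrational x in (0,1) this is the usual continued fraction digit.\<close>
definition cf_digit :: "nat \<Rightarrow> real \<Rightarrow> nat" where
  "cf_digit n x = nat \<lfloor>1 / ((gauss_map ^^ (n - 1)) x)\<rfloor>"

definition cf_prime_digit :: "nat \<Rightarrow> real \<Rightarrow> nat" where
  "cf_prime_digit n x = (if prime (cf_digit n x) then cf_digit n x else 0)"

definition E_prime :: "nat \<Rightarrow> (nat \<Rightarrow> real) \<Rightarrow> real set" where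
  "E_prime l \<phi> = {x \<in> {0..<1}. \<exists>\<^sub>\<infinity> n. n \<ge> 1 \<and>
      (\<Prod>k\<in>{n..<n+l}. real (cf_prime_digit k x)) \<ge> \<phi> n}"

end

theory Submission
  imports Defs
begin

text \<open>
  Conditionally on the first n digits, the Gauss iterate of order n has a density of the form
  c/(s + t y)^2 with 0 \<le> t \<le> s, hence within a factor 4 of uniform. So up to constants the digits
  behave like independent variables taking the value a with probability of order 1/a^2.

  By Chebyshev's bounds a digit is a prime in [2^j, 2^(j+1)) with probability of order 2^(-j)/(j+1).
  For l digits with levels adding up to n the probability is thus of order 2^(-n) times the l-fold
  convolution of 1/(j+1) at n, which is of order (log n)^(l-1)/n. Summing over 2^n \<ge> x gives
  (log log x)^(l-1)/(x log x) for the probability that l consecutive prime digits have product \<ge> x.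

  The convergent case is then Borel--Cantelli. In the divergent case the series diverges along some
  residue class mod l; there the events live on disjoint blocks of digits, and because the lower bound
  is uniform in the past, the probability that none of them occurs is at most a product of factors
  1 - v_j/4 with divergent sum of v_j, hence 0. No zero-one law is needed.
\<close>

text \<open>Everything hinges on one function: the Lebesgue measure v(x) of the points whose first l
  digits are primes with product at least x. Since \<phi> is arbitrary, v has to be squeezed at
  every single x \<ge> 3 between two multiples of (ln ln x)^(l-1) / (x ln x). The given series then
  converges exactly when the sum of v(\<phi>(n)) does, and both halves are proved for that sum.
  Constants may be lossy, because only convergence is at stake. From 3 on, ln ln x is positive and
  bounded away from 0, so additive constants can be absorbed into multiplicative ones.

  The obstacle is dependence: the digits are not independent, and Lebesgue measure is not invariant
  under the Gauss map. The estimates for several digits are therefore proved simultaneously for a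
  whole family of laws with parameters 0 \<le> t \<le> s. Reading off a digit only changes the
  parameters, so an induction on the number of digits can apply its hypothesis to the new
  ones.\<close>

subsection \<open>Chebyshev bounds\<close>

text \<open>The reciprocals of m * (n choose m) form Leibniz' harmonic triangle, so they are integer
  combinations of 1/1, ..., 1/n.\<close>

lemma leibniz_triangle_integral:
  fixes L m n :: nat
  assumes "1 \<le> m" "m \<le> n" "\<forall>k\<in>{1..n}. k dvd L"
  shows "real L / (real m * real (n choose m)) \<in> \<int>"
  using assms
proof (induction m arbitrary: n rule: nat_induct_at_least)
  case base
  then have "n dvd L" by auto
  then obtain q where "L = n * q" by blast
  with base show ?case by auto
next
  case (Suc m)
  have mn: "1 \<le> m" "m \<le> n - 1" "m < n" "0 < n" using Suc by auto
  have 1: "real L / (real m * real (n choose m)) \<in> \<int>"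
    using Suc mn by auto
  have 2: "real L / (real m * real ((n-1) choose m)) \<in> \<int>"
  proof (rule Suc.IH)
    show "\<forall>k\<in>{1..n-1}. k dvd L" using Suc.prems(2) by (meson atLeastAtMost_iff diff_le_self le_trans)
  qed (use mn in auto)
  have a: "real (Suc m) * real (n choose Suc m) = real (n - m) * real (n choose m)"
    by (simp only: of_nat_mult[symmetric] binomial_absorb_comp binomial_absorption)
  have b: "real n * real ((n-1) choose m) = real (n - m) * real (n choose m)"
    by (simp only: of_nat_mult[symmetric] binomial_absorb_comp)
  define C where "C = real (n choose m)"
  have C: "C > 0" using mn by (simp add: C_def)
  have b': "real ((n-1) choose m) = real (n-m) * C / real n"
    using b mn by (simp add: field_simps C_def)
  have nm: "real (n - m) > 0" "real n = real (n-m) + real m" using mn by (simp_all add: of_nat_diff)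
  have "real L / (real (Suc m) * real (n choose Suc m))
      = real L / (real m * real ((n-1) choose m)) - real L / (real m * real (n choose m))"
  proof -
    have "l / (x * C) = l / (y * (x * C / (x + y))) - l / (y * C)"
      if "x > 0" "y > 0" for x y l :: real
      using that C by (simp add: field_simps)
    from this[OF nm(1), of "real m" "real L"] mn(1) show ?thesis
      unfolding a b' C_def[symmetric] nm(2)[symmetric] by fastforce
  qed
  then show ?case using 1 2 by (metis Ints_diff)
qed

text \<open>A positive integer is at least 1, so \<open>L\<close> dominates even m times the
  binomial coefficient. This is Nair's way of bounding lcm(1, ..., n) from below.\<close>

lemma binomial_le_if_common_multiple:
  fixes L m n :: nat
  assumes "1 \<le> m" "m \<le> n" "\<forall>k\<in>{1..n}. k dvd L" "L > 0"
  shows "n choose m \<le> L"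
proof -
  have I: "real L / (real m * real (n choose m)) \<in> \<int>"
    using leibniz_triangle_integral assms by blast
  have p: "real m * real (n choose m) > 0" using assms by simp
  have "real L / (real m * real (n choose m)) > 0" using p assms by simp
  with I have "real L / (real m * real (n choose m)) \<ge> 1"
    by (auto elim!: Ints_cases)
  then have "real m * real (n choose m) \<le> real L"
    using p by (simp add: field_simps)
  moreover have "1 * real (n choose m) \<le> real m * real (n choose m)"
    using assms by (intro mult_right_mono) auto
  ultimately show ?thesis by simp
qed

section \<open>Counting primes up to powers of two\<close>

definition primes_upto :: "nat \<Rightarrow> nat set" where
  "primes_upto n = {p. prime p \<and> p \<le> n}"

lemma finite_primes_upto [simp]: "finite (primes_upto n)"
  unfolding primes_upto_def by (rule finite_subset[of _ "{..n}"]) auto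

text \<open>The witness is lcm(1, ..., n), written as the product of the largest prime powers not
  exceeding n. Each of these factors is at most n, so a lower bound for a common multiple becomes a
  lower bound for the number of primes.\<close>

lemma primes_upto_common_multiple:
  fixes n :: nat
  assumes "n \<ge> 1"
  obtains L where "L > 0" "L \<le> n ^ card (primes_upto n)" "\<forall>k\<in>{1..n}. k dvd L"
proof -
  define P where "P = primes_upto n"
  have fP: "finite P" unfolding P_def by simp
  define e where "e p = (GREATEST e. p ^ e \<le> n)" for p :: nat
  have bound: "k \<le> n" if "p \<in> P" "p ^ k \<le> n" for p k
  proof -
    have "p \<ge> 2" using that prime_ge_2_nat by (auto simp: P_def primes_upto_def primes_upto_def)
    then have "k < p ^ k" by (intro power_gt_expt) simp
    then show ?thesis using that by simp
  qed
  have e1: "p ^ e p \<le> n" if "p \<in> P" for p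
    unfolding e_def by (rule GreatestI_nat[of _ 0 n]) (use assms bound[OF that] in auto)
  have e2: "k \<le> e p" if "p \<in> P" "p ^ k \<le> n" for p k
    unfolding e_def by (rule Greatest_le_nat[of _ _ n]) (use that bound[OF that(1)] in auto)
  define L where "L = (\<Prod>p\<in>P. p ^ e p)"
  have "L > 0" unfolding L_def
    by (intro prod_pos) (auto simp: P_def primes_upto_def prime_gt_0_nat)
  moreover have "L \<le> n ^ card P"
    unfolding L_def using prod_le_power[of P "\<lambda>p. p ^ e p" n "card P"] e1 assms fP by auto
  moreover have "k dvd L" if k: "k \<in> {1..n}" for k
  proof -
    have k0: "k > 0" using k by simp
    have sub: "prime_factors k \<subseteq> P"
      using k by (auto simp: P_def primes_upto_def prime_factors_dvd dest: dvd_imp_le)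
    have "k = (\<Prod>p\<in>prime_factors k. p ^ multiplicity p k)"
      using k0 by (simp add: prime_factorization_nat)
    also have "\<dots> dvd (\<Prod>p\<in>prime_factors k. p ^ e p)"
    proof (intro prod_dvd_prod le_imp_power_dvd e2)
      fix p assume p: "p \<in> prime_factors k"
      then show "p \<in> P" using sub by auto
      have "p ^ multiplicity p k \<le> k" using k0 by (intro dvd_imp_le multiplicity_dvd) auto
      then show "p ^ multiplicity p k \<le> n" using k by simp
    qed
    also have "\<dots> dvd L" unfolding L_def using fP sub by (rule prod_dvd_prod_subset)
    finally show ?thesis .
  qed
  ultimately show ?thesis using that unfolding P_def by blast
qed

lemma card_primes_upto_le: "card (primes_upto n) \<le> n"
proof -
  have "primes_upto n \<subseteq> {1..n}" unfolding primes_upto_def using prime_ge_1_nat by auto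
  then have "card (primes_upto n) \<le> card {1..n}" by (intro card_mono) auto
  then show ?thesis by simp
qed

text \<open>With 2n = 2^k, the chain 4^n / (2n) \<le> (2n choose n) \<le> lcm \<le> (2n)^\<pi>(2n)
  has powers of 2 at both ends. Comparing exponents gives the claim without logarithms.\<close>

lemma chebyshev_lower:
  assumes "k \<ge> 1"
  shows "2 ^ k \<le> k * (card (primes_upto (2 ^ k)) + 1)"
proof -
  obtain j where j: "k = Suc j" using assms by (cases k) auto
  define n :: nat where "n = 2 ^ j"
  have n: "n \<ge> 1" "2 * n = 2 ^ k" by (auto simp: n_def j)
  obtain L where L: "L > 0" "L \<le> (2*n) ^ card (primes_upto (2*n))" "\<forall>k\<in>{1..2*n}. k dvd L"
    using primes_upto_common_multiple[of "2*n"] n by auto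
  have "(2*n choose n) \<le> L"
    using binomial_le_if_common_multiple[of n "2*n" L] L n by auto
  then have 1: "(2*n choose n) \<le> 2 ^ (k * card (primes_upto (2^k)))"
    using L n by (simp add: power_mult)
  have "4 ^ n / (2 * real n) \<le> real (2*n choose n)"
    using central_binomial_lower_bound[of n] n by simp
  then have "4 ^ n \<le> 2 * real n * real (2*n choose n)" using n by (simp add: field_simps)
  then have "real (4 ^ n) \<le> real (2 * n * (2*n choose n))" by simp
  then have "4 ^ n \<le> 2 * n * (2*n choose n)" by (simp only: of_nat_le_iff)
  also have "\<dots> \<le> 2 * n * 2 ^ (k * card (primes_upto (2^k)))"
    using 1 by simp
  also have "\<dots> = 2 ^ (k + k * card (primes_upto (2^k)))"
    using n by (simp add: power_add)
  finally have "2 ^ (2 * n) \<le> (2::nat) ^ (k + k * card (primes_upto (2^k)))"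
    by (simp add: power_mult)
  then show ?thesis using n by simp
qed

lemma prod_primes_dvd:
  fixes N :: nat
  assumes "finite A" "\<And>p. p \<in> A \<Longrightarrow> prime p" "\<And>p. p \<in> A \<Longrightarrow> p dvd N"
  shows "\<Prod>A dvd N"
  using assms
proof (induction A rule: finite_induct)
  case (insert p A)
  have "coprime p (\<Prod>A)"
    using insert by (intro prod_coprime_right) (metis insertCI primes_coprime)
  then show ?case using insert by (auto intro: divides_mult)
qed auto

text \<open>Every prime in (n, 2n] divides the central binomial coefficient, which is at most 4^n,
  while the product of these primes is at least n to their number. For n = 2^j the exponents can be
  compared.\<close>

lemma card_primes_dyadic_le:
  "j * card {p. prime p \<and> 2 ^ j < p \<and> p \<le> (2::nat) ^ Suc j} \<le> 2 ^ Suc j"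
proof -
  define n :: nat where "n = 2 ^ j"
  define A where "A = {p. prime p \<and> n < p \<and> p \<le> 2 * n}"
  have A: "A = {p. prime p \<and> 2 ^ j < p \<and> p \<le> (2::nat) ^ Suc j}" by (auto simp: A_def n_def)
  have fA: "finite A" unfolding A_def by (rule finite_subset[of _ "{..2*n}"]) auto
  have "\<Prod>A dvd (2*n choose n)"
  proof (rule prod_primes_dvd[OF fA])
    fix p assume p: "p \<in> A"
    then show pp: "prime p" by (simp add: A_def)
    have "p dvd fact (2*n)" using p pp by (simp add: A_def prime_dvd_fact_iff)
    also have "fact (2*n) = fact n * fact n * (2*n choose n)"
      using binomial_fact_lemma[of n "2*n"] by simp
    finally show "p dvd (2*n choose n)"
      using p pp by (auto simp: A_def prime_dvd_mult_iff prime_dvd_fact_iff)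
  qed
  then have "\<Prod>A \<le> (2*n choose n)" by (intro dvd_imp_le) auto
  also have "\<dots> \<le> 2 ^ (2*n)" by (rule binomial_le_pow2)
  finally have "\<Prod>A \<le> 2 ^ (2*n)" .
  moreover have "n ^ card A \<le> \<Prod>A"
  proof -
    have "(\<Prod>p\<in>A. n) \<le> (\<Prod>p\<in>A. p)" by (intro prod_mono) (auto simp: A_def)
    then show ?thesis by simp
  qed
  ultimately have "n ^ card A \<le> 2 ^ (2*n)" by linarith
  then have "(2::nat) ^ (j * card A) \<le> 2 ^ (2*n)" by (simp add: n_def power_mult)
  then have "j * card A \<le> 2 * n" by simp
  then show ?thesis by (simp add: A n_def)
qed

lemma primes_upto_split:
  assumes "m \<le> n"
  shows "card (primes_upto n) = card (primes_upto m) + card {p. prime p \<and> m < p \<and> p \<le> n}"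
proof -
  have "primes_upto n = primes_upto m \<union> {p. prime p \<and> m < p \<and> p \<le> n}"
    using assms by (auto simp: primes_upto_def)
  moreover have "finite {p. prime p \<and> m < p \<and> p \<le> n}"
    by (rule finite_subset[of _ "{..n}"]) auto
  ultimately show ?thesis
    by (simp add: card_Un_disjoint primes_upto_def disjoint_iff)
qed

text \<open>Dyadic blocks are added one at a time. Passing from the factor k to k + 1 costs at most
  4/3 once k \<ge> 3, and 4 is the constant C that reproduces itself: 4/3 * (C + 2) = 2 C. Below 3
  the trivial bound suffices.\<close>

lemma chebyshev_upper:
  "k * card (primes_upto (2 ^ k)) \<le> 4 * 2 ^ k"
proof (cases "k \<ge> 3")
  case False
  then have "k \<le> 4" by simp
  then show ?thesis using card_primes_upto_le[of "2^k"] by (intro mult_le_mono) auto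
next
  case True
  then show ?thesis
  proof (induction k rule: nat_induct_at_least)
    case base
    then show ?case using card_primes_upto_le[of 8] by simp
  next
    case (Suc k)
    define c where "c = card {p. prime p \<and> 2 ^ k < p \<and> p \<le> (2::nat) ^ Suc k}"
    define d where "d = card (primes_upto (2 ^ k))"
    have s: "card (primes_upto (2 ^ Suc k)) = d + c"
      unfolding c_def d_def by (rule primes_upto_split) simp
    have 1: "k * c \<le> 2 * 2 ^ k" using card_primes_dyadic_le[of k] by (simp add: c_def)
    have 2: "k * d \<le> 4 * 2 ^ k" using Suc by (simp add: d_def)
    have "3 * Suc k * (d + c) \<le> 4 * k * (d + c)"
      using Suc.hyps by (intro mult_le_mono1) simp
    also have "\<dots> \<le> 4 * (6 * 2 ^ k)" using 1 2 by (simp add: algebra_simps)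
    finally show ?case unfolding s by (simp add: algebra_simps)
  qed
qed

lemma card_prime_block_upper:
  "(j + 1) * card {p::nat. prime p \<and> 2 ^ j \<le> p \<and> p < 2 ^ Suc j} \<le> 5 * 2 ^ j"
proof (cases "j = 0")
  case True
  have "{p::nat. prime p \<and> 2 ^ j \<le> p \<and> p < 2 ^ Suc j} \<subseteq> {1}" using True by auto
  then have "card {p::nat. prime p \<and> 2 ^ j \<le> p \<and> p < 2 ^ Suc j} \<le> 1"
    using card_mono[of "{1::nat}"] by fastforce
  then show ?thesis using True by simp
next
  case False
  define c where "c = card {p. prime p \<and> 2 ^ j < p \<and> p \<le> (2::nat) ^ Suc j}"
  have fin: "finite {p. prime p \<and> 2 ^ j < p \<and> p \<le> (2::nat) ^ Suc j}"
    by (rule finite_subset[of _ "{..2 ^ Suc j}"]) auto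
  \<comment> \<open>Moving the block from (2^j, 2^(j+1)] to [2^j, 2^(j+1)) can gain only the left
    endpoint, which is prime for j = 1.\<close>
  have "card {p::nat. prime p \<and> 2 ^ j \<le> p \<and> p < 2 ^ Suc j}
      \<le> card (insert (2^j) {p. prime p \<and> 2 ^ j < p \<and> p \<le> (2::nat) ^ Suc j})"
    by (intro card_mono) (use fin in auto)
  also have "\<dots> \<le> c + 1" using fin by (auto simp: c_def card_insert_if)
  finally have 1: "card {p::nat. prime p \<and> 2 ^ j \<le> p \<and> p < 2 ^ Suc j} \<le> c + 1" .
  have 2: "j * c \<le> 2 * 2 ^ j" using card_primes_dyadic_le[of j] by (simp add: c_def)
  have "1 * c \<le> j * c" using False by (intro mult_le_mono1) simp
  have "(j + 1) * (c + 1) = j * c + 1 * c + j + 1" by (simp add: algebra_simps)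
  also have "\<dots> \<le> 2 * 2 ^ j + 2 * 2 ^ j + j + 1" using 2 \<open>1 * c \<le> j * c\<close> by linarith
  also have "\<dots> \<le> 5 * 2 ^ j" using less_exp[of j] by linarith
  finally show ?thesis using 1 by (meson le_trans mult_le_mono2)
qed

text \<open>For k = 4 (j + 1) there are at least 8 * 2^k / k - 1 primes up to 2^(k+4), and at most 4
  * 2^k / k of them lie below 2^k. The 8 is 16 divided by 2, from k + 4 \<le> 2k; this uses k \<ge>
  4, which is why the blocks start at 16 and not at 1.\<close>

lemma card_prime_block_lower:
  "3 * 16 ^ (j + 1) \<le> 4 * (j + 1) * card {p::nat. prime p \<and> 16 ^ (j + 1) < p \<and> p \<le> 16 ^ (j + 2)}"
proof -
  define k where "k = 4 * (j + 1)"
  have e: "(16::nat) ^ (j + 1) = 2 ^ k" "(16::nat) ^ (j + 2) = 2 ^ (k + 4)"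
    by (simp_all add: k_def power_add power_mult)
  define c where "c = card {p::nat. prime p \<and> 2 ^ k < p \<and> p \<le> 2 ^ (k + 4)}"
  define d where "d = card (primes_upto (2 ^ k))"
  have s: "card (primes_upto (2 ^ (k + 4))) = d + c"
    unfolding c_def d_def by (rule primes_upto_split) simp
  have 1: "2 ^ (k + 4) \<le> (k + 4) * (d + c + 1)"
    using chebyshev_lower[of "k+4"] by (simp add: s)
  have 2: "k * d \<le> 4 * 2 ^ k" using chebyshev_upper[of k] by (simp add: d_def)
  have "k \<ge> 4" by (simp add: k_def)
  then have "(k + 4) * (d + c + 1) \<le> (2 * k) * (d + c + 1)" by (intro mult_le_mono1) simp
  with 1 have "16 * 2 ^ k \<le> 2 * (k * d + k * c + k)" by (simp add: power_add algebra_simps)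
  then have "8 * 2 ^ k \<le> k * d + k * c + k" by presburger
  with 2 less_exp[of k] have "3 * 2 ^ k \<le> k * c" by linarith
  then show ?thesis unfolding e c_def k_def[symmetric] .
qed

subsection \<open>Convolution powers of the harmonic sequence\<close>

fun harmonic_conv :: "nat \<Rightarrow> nat \<Rightarrow> real" where
  "harmonic_conv 0 s = (if s = 0 then 1 else 0)"
| "harmonic_conv (Suc l) s = (\<Sum>j\<le>s. harmonic_conv l (s - j) / real (j + 1))"

lemma harm_ge_1: "(harm (Suc n) :: real) \<ge> 1"
  using harm_mono[of "Suc 0" "Suc n", where ?'a = real] by (simp add: harm_expand)

lemma harm_le_1_plus_ln: "(harm (Suc n) :: real) \<le> 1 + ln (real (Suc n))"
  using decseq_harm_diff_ln unfolding decseq_def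
  by (drule_tac spec[of _ 0], drule_tac spec[of _ n]) (simp add: harm_expand)

lemma harm_Suc_altdef: "(harm (Suc s) :: real) = (\<Sum>j\<le>s. 1 / real (j + 1))"
  unfolding harm_altdef lessThan_Suc_atMost by (simp add: field_simps)

lemma harm_double: "(harm (2 * n) :: real) \<le> 2 * harm n"
proof (induction n)
  case (Suc n)
  have "(harm (2 * Suc n) :: real) = harm (2 * n) + inverse (real (2*n+1)) + inverse (real (2*n+2))"
    by (simp add: harm_Suc)
  also have "\<dots> \<le> 2 * harm n + inverse (real (n+1)) + inverse (real (n+1))"
    by (intro add_mono Suc.IH le_imp_inverse_le) auto
  also have "\<dots> = 2 * harm (Suc n)" by (simp add: harm_Suc)
  finally show ?case .
qed (simp add: harm_def)

text \<open>Slow variation of harmonic numbers: halving the index costs at most a factor 2. In the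
  lower bound for the convolutions this replaces all indices in the upper half by the largest
  one.\<close>

lemma harm_half:
  assumes "s \<le> 2 * u + 1"
  shows "(harm (Suc s) :: real) / 2 \<le> harm (Suc u)"
  using harm_mono[of "Suc s" "2 * Suc u", where ?'a = real] harm_double[of "Suc u"] assms by simp

text \<open>Crude, but it separates i from m: the linear growth in i is later absorbed by a factor
  (1/2)^i.\<close>

lemma harm_add_le: "(harm (Suc m + i) :: real) \<le> harm (Suc m) * (1 + real i)"
proof (induction i)
  case (Suc i)
  have "(harm (Suc m + Suc i) :: real) = harm (Suc m + i) + inverse (real (Suc (Suc m + i)))"
    by (simp add: harm_Suc)
  also have "\<dots> \<le> harm (Suc m) * (1 + real i) + 1"
    by (intro add_mono Suc.IH) (auto simp: field_simps)
  also have "\<dots> \<le> harm (Suc m) * (1 + real i) + harm (Suc m)" using harm_ge_1[of m] by simp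
  also have "\<dots> = harm (Suc m) * (1 + real (Suc i))" by (simp add: algebra_simps)
  finally show ?case .
qed simp

lemma harmonic_conv_1: "harmonic_conv (Suc 0) s = 1 / real (s + 1)"
proof -
  have "harmonic_conv (Suc 0) s = (\<Sum>j\<in>{s}. harmonic_conv 0 (s - j) / real (j + 1))"
    unfolding harmonic_conv.simps(2) by (intro sum.mono_neutral_right) auto
  then show ?thesis by simp
qed

text \<open>Partial fractions: 1/(xy) = (1/x + 1/y)/(x + y), where x + y = s + 2 does not depend on
  j. This is the source of the one harmonic number, hence the one logarithm, gained by each
  convolution.\<close>

lemma sum_inverse_products:
  "(\<Sum>j\<le>s. 1 / (real (j + 1) * real (s - j + 1))) = 2 * harm (Suc s) / real (s + 2)"
proof -
  have "(\<Sum>j\<le>s. 1 / (real (j + 1) * real (s - j + 1)))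
      = (\<Sum>j\<le>s. (1 / real (j + 1) + 1 / real (s - j + 1)) / real (s + 2))"
  proof (rule sum.cong[OF refl])
    fix j assume "j \<in> {..s}"
    then have e: "real (s + 2) = real (j + 1) + real (s - j + 1)" by (simp add: of_nat_diff)
    have "1 / (x * y) = (1 / x + 1 / y) / (x + y)" if "x > 0" "y > 0" for x y :: real
    proof -
      have "1 / x + 1 / y = (x + y) / (x * y)" using that by (simp add: field_simps)
      then show ?thesis using that by simp
    qed
    from this[of "real (j+1)" "real (s-j+1)"]
    show "1 / (real (j + 1) * real (s - j + 1)) = (1 / real (j + 1) + 1 / real (s - j + 1)) / real (s + 2)"
      unfolding e by simp
  qed
  also have "\<dots> = ((\<Sum>j\<le>s. 1 / real (j + 1)) + (\<Sum>j\<le>s. 1 / real (s - j + 1))) / real (s + 2)"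
    by (simp only: sum_divide_distrib[symmetric] sum.distrib)
  also have "(\<Sum>j\<le>s. 1 / real (s - j + 1)) = (\<Sum>j\<le>s. 1 / real (j + 1))"
    using sum.nat_diff_reindex[of "\<lambda>j. 1 / real (j+1)" "Suc s"] by (simp add: lessThan_Suc_atMost)
  finally show ?thesis by (simp add: harm_Suc_altdef)
qed

lemma harmonic_conv_nonneg: "harmonic_conv l s \<ge> 0"
  by (induction l arbitrary: s) (auto intro!: sum_nonneg)

text \<open>Harmonic numbers at s - j are at most those at s and can be pulled out of the sum; what
  is left is the closed form above, with its factor 2.\<close>

lemma harmonic_conv_upper:
  "harmonic_conv (Suc l) s \<le> 2 ^ l * harm (Suc s) ^ l / real (s + 1)"
proof (induction l arbitrary: s)
  case (Suc l)
  have "harmonic_conv (Suc (Suc l)) s = (\<Sum>j\<le>s. harmonic_conv (Suc l) (s - j) / real (j + 1))"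
    by (rule harmonic_conv.simps)
  also have "\<dots> \<le> (\<Sum>j\<le>s. (2 ^ l * harm (Suc s) ^ l) * (1 / (real (j + 1) * real (s - j + 1))))"
  proof (rule sum_mono)
    fix j assume "j \<in> {..s}"
    have "harmonic_conv (Suc l) (s - j) \<le> 2 ^ l * harm (Suc (s - j)) ^ l / real (s - j + 1)"
      by (rule Suc.IH)
    also have "\<dots> \<le> 2 ^ l * harm (Suc s) ^ l / real (s - j + 1)"
      by (intro divide_right_mono mult_left_mono power_mono harm_mono harm_nonneg) auto
    finally have "harmonic_conv (Suc l) (s - j) / real (j + 1)
        \<le> 2 ^ l * harm (Suc s) ^ l / real (s - j + 1) / real (j + 1)"
      by (intro divide_right_mono) auto
    then show "harmonic_conv (Suc l) (s - j) / real (j + 1)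
        \<le> (2 ^ l * harm (Suc s) ^ l) * (1 / (real (j + 1) * real (s - j + 1)))"
      by (simp add: mult_ac)
  qed
  also have "\<dots> = 2 ^ l * harm (Suc s) ^ l * (2 * harm (Suc s) / real (s + 2))"
    by (simp only: sum_distrib_left[symmetric] sum_inverse_products)
  also have "\<dots> \<le> 2 ^ l * harm (Suc s) ^ l * (2 * harm (Suc s) / real (s + 1))"
    by (intro mult_left_mono divide_left_mono mult_nonneg_nonneg zero_le_power harm_nonneg) auto
  also have "\<dots> = 2 ^ Suc l * harm (Suc s) ^ Suc l / real (s + 1)" by simp
  finally show ?case .
qed (simp add: harmonic_conv_1 del: harmonic_conv.simps)

text \<open>Only the terms with j \<le> s/2 are kept. There s - j is at least s/2, so each of the l
  harmonic numbers loses at most a factor 2, and so does the remaining sum of 1/(j + 1); together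
  this is the 2^(l+1) in the witness.\<close>

lemma harmonic_conv_lower:
  "\<exists>b>0. \<forall>s. harmonic_conv (Suc l) s \<ge> b * harm (Suc s) ^ l / real (s + 1)"
proof (induction l)
  case 0
  show ?case by (rule exI[of _ 1]) (simp add: harmonic_conv_1 del: harmonic_conv.simps)
next
  case (Suc l)
  then obtain b where b: "b > 0" "\<And>s. harmonic_conv (Suc l) s \<ge> b * harm (Suc s) ^ l / real (s + 1)"
    by blast
  show ?case
  proof (intro exI[of _ "b / 2 ^ Suc l"] conjI allI)
    show "b / 2 ^ Suc l > 0" using b by simp
    fix s :: nat
    define u where "u = s div 2"
    have u: "u \<le> s" "2 * u \<le> s" "s \<le> 2 * u + 1" by (auto simp: u_def)
    have "b / 2 ^ Suc l * harm (Suc s) ^ Suc l / real (s + 1)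
        = b * (harm (Suc s) / 2) ^ l / real (s + 1) * (harm (Suc s) / 2)"
      by (simp add: power_divide mult_ac)
    also have "\<dots> \<le> b * (harm (Suc s) / 2) ^ l / real (s + 1) * harm (Suc u)"
      using b by (intro mult_left_mono harm_half u mult_nonneg_nonneg divide_nonneg_nonneg zero_le_power harm_nonneg) auto
    also have "\<dots> = (\<Sum>j\<le>u. b * (harm (Suc s) / 2) ^ l / real (s + 1) / real (j + 1))"
      unfolding harm_Suc_altdef[of u] sum_distrib_left by simp
    also have "\<dots> \<le> (\<Sum>j\<le>u. harmonic_conv (Suc l) (s - j) / real (j + 1))"
    proof (intro sum_mono divide_right_mono)
      fix j assume j: "j \<in> {..u}"
      have "b * (harm (Suc s) / 2) ^ l / real (s + 1) \<le> b * harm (Suc (s - j)) ^ l / real (s - j + 1)"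
        using b j u by (intro frac_le mult_nonneg_nonneg mult_left_mono power_mono harm_half harm_nonneg
            zero_le_power divide_nonneg_nonneg) auto
      also have "\<dots> \<le> harmonic_conv (Suc l) (s - j)" by (rule b)
      finally show "b * (harm (Suc s) / 2) ^ l / real (s + 1) \<le> harmonic_conv (Suc l) (s - j)" .
    qed auto
    also have "\<dots> \<le> (\<Sum>j\<le>s. harmonic_conv (Suc l) (s - j) / real (j + 1))"
      using u by (intro sum_mono2) (auto intro!: divide_nonneg_nonneg harmonic_conv_nonneg simp del: harmonic_conv.simps)
    also have "\<dots> = harmonic_conv (Suc (Suc l)) s" by simp
    finally show "b / 2 ^ Suc l * harm (Suc s) ^ Suc l / real (s + 1) \<le> harmonic_conv (Suc (Suc l)) s" .
  qed
qed

lemma summable_geometric_times_power: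
  "summable (\<lambda>i. (1 / 2) ^ i * (1 + real i) ^ l)"
proof -
  have "(\<lambda>i. (1/2) * (1 + 1 / real (Suc i)) ^ l) \<longlonglongrightarrow> (1/2) * (1 + 0) ^ l"
    by (intro tendsto_intros LIMSEQ_Suc[OF lim_1_over_n])
  then have "eventually (\<lambda>i. (1/2) * (1 + 1 / real (Suc i)) ^ l < 3/4) sequentially"
    by (rule order_tendstoD) simp
  then obtain N where N: "\<And>i. i \<ge> N \<Longrightarrow> (1/2) * (1 + 1 / real (Suc i)) ^ l < 3/4"
    unfolding eventually_sequentially by blast
  show ?thesis
  proof (rule summable_ratio_test[of "3/4" N])
    fix i assume i: "N \<le> i"
    have "(1 / 2) ^ Suc i * (1 + real (Suc i)) ^ l
        = ((1/2) * (1 + 1 / real (Suc i)) ^ l) * ((1 / 2) ^ i * (1 + real i) ^ l)"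
    proof -
      have "1 + real (Suc i) = (1 + 1 / real (Suc i)) * (1 + real i)" by (simp add: field_simps)
      then show ?thesis by (simp only: power_mult_distrib power_Suc mult_ac)
    qed
    also have "\<dots> \<le> 3/4 * ((1 / 2) ^ i * (1 + real i) ^ l)"
      using N[OF i] by (intro mult_right_mono) auto
    finally show "norm ((1 / 2) ^ Suc i * (1 + real (Suc i)) ^ l) \<le> 3/4 * norm ((1 / 2) ^ i * (1 + real i) ^ l)"
      by simp
  qed simp
qed

text \<open>The geometric factor beats the polynomial growth in i, so the whole tail is of the order
  of its first term.\<close>

lemma harmonic_conv_tail:
  "\<exists>C>0. \<forall>m. summable (\<lambda>i. (1 / 2) ^ (m + i) * harmonic_conv (Suc l) (m + i)) \<and>
     (\<Sum>i. (1 / 2) ^ (m + i) * harmonic_conv (Suc l) (m + i))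
       \<le> C * ((1 / 2) ^ m * harm (Suc m) ^ l / real (m + 1))"
proof -
  define S where "S = (\<Sum>i. (1 / 2 :: real) ^ i * (1 + real i) ^ l)"
  note sg = summable_geometric_times_power[of l]
  have "S > 0" unfolding S_def by (rule suminf_pos[OF sg]) auto
  show ?thesis
  proof (intro exI[of _ "2 ^ l * S"] conjI allI)
    show "2 ^ l * S > 0" using \<open>S > 0\<close> by simp
    fix m
    define D where "D = 2 ^ l * ((1 / 2) ^ m * harm (Suc m) ^ l / real (m + 1))"
    have le: "(1 / 2) ^ (m + i) * harmonic_conv (Suc l) (m + i) \<le> D * ((1 / 2) ^ i * (1 + real i) ^ l)" for i
    proof -
      have "harmonic_conv (Suc l) (m + i) \<le> 2 ^ l * harm (Suc (m + i)) ^ l / real (m + i + 1)"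
        by (rule harmonic_conv_upper)
      also have "\<dots> \<le> 2 ^ l * (harm (Suc m) * (1 + real i)) ^ l / real (m + 1)"
        using harm_add_le[of m i]
        by (intro frac_le mult_left_mono power_mono mult_nonneg_nonneg zero_le_power harm_nonneg) auto
      finally have "(1 / 2) ^ (m + i) * harmonic_conv (Suc l) (m + i)
          \<le> (1 / 2) ^ (m + i) * (2 ^ l * (harm (Suc m) * (1 + real i)) ^ l / real (m + 1))"
        by (intro mult_left_mono) auto
      also have "\<dots> = D * ((1 / 2) ^ i * (1 + real i) ^ l)"
        unfolding D_def by (simp add: power_add power_mult_distrib)
      finally show ?thesis .
    qed
    have sD: "summable (\<lambda>i. D * ((1 / 2) ^ i * (1 + real i) ^ l))" by (intro summable_mult sg)
    show s: "summable (\<lambda>i. (1 / 2) ^ (m + i) * harmonic_conv (Suc l) (m + i))"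
      using le harmonic_conv_nonneg
      by (intro summable_comparison_test[OF _ sD] exI[of _ 0]) (auto simp del: harmonic_conv.simps)
    have "(\<Sum>i. (1 / 2) ^ (m + i) * harmonic_conv (Suc l) (m + i)) \<le> (\<Sum>i. D * ((1 / 2) ^ i * (1 + real i) ^ l))"
      by (intro suminf_le le s sD)
    also have "\<dots> = D * S" unfolding S_def by (rule suminf_mult[OF sg])
    finally show "(\<Sum>i. (1 / 2) ^ (m + i) * harmonic_conv (Suc l) (m + i))
       \<le> 2 ^ l * S * ((1 / 2) ^ m * harm (Suc m) ^ l / real (m + 1))"
      by (simp add: D_def mult_ac)
  qed
qed

section \<open>From total levels to thresholds x\<close>

lemma ln3_gt_1: "ln (3::real) > 1"
proof -
  have "3 * ln (2::real) = ln (2 ^ 3)" by (subst ln_realpow) auto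
  also have "\<dots> < ln (3 ^ 2)" by simp
  also have "\<dots> = 2 * ln (3::real)" by (subst ln_realpow) auto
  finally show ?thesis using ln2_ge_two_thirds by simp
qed

lemma ln_ge_1_if_ge_3: "x \<ge> (3::real) \<Longrightarrow> ln x > 1"
  using ln3_gt_1 ln_mono[of 3 x] by linarith

lemma log_2_bounds:
  assumes "x \<ge> (3::real)"
  shows "ln x \<le> log 2 x" "log 2 x \<le> 3/2 * ln x"
proof -
  have l: "2/3 \<le> ln (2::real)" "ln (2::real) \<le> 1" using ln2_ge_two_thirds ln_le_minus_one[of 2] by auto
  have p: "ln x > 0" using ln_ge_1_if_ge_3[OF assms] by simp
  show "ln x \<le> log 2 x" using l p by (simp add: log_def field_simps)
  have "2/3 * ln x \<le> ln 2 * ln x" using l p by (intro mult_right_mono) auto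
  then show "log 2 x \<le> 3/2 * ln x" using l p by (simp add: log_def field_simps)
qed

text \<open>Primes whose k + 1 dyadic levels add up to n have a product below 2^(n+k+1), so no total
  level smaller than this \<open>m\<close> can reach x.\<close>

lemma dyadic_rate_upper:
  "\<exists>C>0. \<forall>x\<ge>3. \<forall>m. m = nat \<lfloor>log 2 x\<rfloor> - k \<longrightarrow>
     (1 / 2) ^ m * harm (Suc m) ^ k / real (m + 1) \<le> C * (ln (ln x) ^ k / (x * ln x))"
proof -
  \<comment> \<open>Chosen so that 1 + ln 3 + t \<le> c t for all t \<ge> ln (ln 3). It is applied
    to t = ln (ln x), since the harmonic number at m + 1 is at most 1 + ln (3 ln x).\<close>
  define c where "c = 1 + (1 + ln 3) / ln (ln (3::real))"
  have ll3: "ln (ln (3::real)) > 0" using ln3_gt_1 by simp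
  have c: "c > 0" unfolding c_def using ll3 ln3_gt_1 by (intro add_pos_pos divide_pos_pos) auto
  show ?thesis
  \<comment> \<open>The three factors come from x \<le> 2^(m+k+1), from ln x \<le> (k + 1)(m + 1),
    and from the k harmonic numbers.\<close>
  proof (intro exI[of _ "2 ^ Suc k * real (k + 1) * c ^ k"] conjI allI impI)
    show "2 ^ Suc k * real (k + 1) * c ^ k > 0" using c by simp
    fix x :: real and m assume x: "x \<ge> 3" and m: "m = nat \<lfloor>log 2 x\<rfloor> - k"
    note L = log_2_bounds[OF x]
    have lx: "ln x > 1" using ln_ge_1_if_ge_3[OF x] .
    have fl: "real (nat \<lfloor>log 2 x\<rfloor>) \<le> log 2 x" "log 2 x \<le> real (nat \<lfloor>log 2 x\<rfloor>) + 1"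
      using L lx by (auto simp: of_nat_nat)
    have mk: "log 2 x \<le> real (m + Suc k)" using fl m by linarith
    have "x = 2 powr log 2 x" using x by simp
    also have "\<dots> \<le> 2 powr real (m + Suc k)" using mk by simp
    also have "\<dots> = 2 ^ (m + Suc k)" by (rule powr_realpow) simp
    finally have "x \<le> 2 ^ m * 2 ^ Suc k" by (simp only: power_add)
    then have 1: "(1 / 2) ^ m \<le> 2 ^ Suc k / x" using x by (simp add: field_simps power_one_over)
    have "ln x \<le> real (m + Suc k)" using mk L by linarith
    also have "\<dots> \<le> real (k + 1) * real (m + 1)" by (simp add: algebra_simps)
    finally have 2: "1 / real (m + 1) \<le> real (k + 1) / ln x" using lx by (simp add: field_simps)
    have "real (Suc m) \<le> log 2 x + 1" using fl m by linarith
    also have "\<dots> \<le> 3 * ln x" using L lx by linarith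
    finally have "ln (real (Suc m)) \<le> ln (3 * ln x)" using lx by (subst ln_le_cancel_iff) auto
    also have "\<dots> = ln 3 + ln (ln x)" using lx by (simp add: ln_mult)
    finally have h: "harm (Suc m) \<le> 1 + ln 3 + ln (ln x)" using harm_le_1_plus_ln[of m] by linarith
    have "ln (ln 3) \<le> ln (ln x)" using x ln3_gt_1 by (intro ln_mono) auto
    then have "(1 + ln 3) / ln (ln 3) * ln (ln 3) \<le> (1 + ln 3) / ln (ln 3) * ln (ln x)"
      using ll3 ln3_gt_1 by (intro mult_left_mono divide_nonneg_nonneg) auto
    then have "1 + ln 3 \<le> (1 + ln 3) / ln (ln 3) * ln (ln x)" using ll3 by simp
    then have "1 + ln 3 + ln (ln x) \<le> c * ln (ln x)" unfolding c_def distrib_right by linarith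
    with h have "harm (Suc m) \<le> c * ln (ln x)" by linarith
    then have 3: "harm (Suc m) ^ k \<le> c ^ k * ln (ln x) ^ k"
      unfolding power_mult_distrib[symmetric] by (intro power_mono harm_nonneg) auto
    have llx: "ln (ln x) > 0" using lx by simp
    have "(1 / 2) ^ m * harm (Suc m) ^ k / real (m + 1) = (1 / 2) ^ m * harm (Suc m) ^ k * (1 / real (m + 1))"
      by simp
    also have "\<dots> \<le> (2 ^ Suc k / x) * (c ^ k * ln (ln x) ^ k) * (real (k + 1) / ln x)"
      using c llx lx x
      by (intro mult_mono 1 2 3 mult_nonneg_nonneg zero_le_power harm_nonneg) auto
    also have "\<dots> = 2 ^ Suc k * real (k + 1) * c ^ k * (ln (ln x) ^ k / (x * ln x))"
      using lx x by (simp add: field_simps)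
    finally show "(1 / 2) ^ m * harm (Suc m) ^ k / real (m + 1)
      \<le> 2 ^ Suc k * real (k + 1) * c ^ k * (ln (ln x) ^ k / (x * ln x))" .
  qed
qed

lemma hexadic_rate_lower:
  "\<exists>c>0. \<forall>x\<ge>3. \<exists>s. x \<le> 16 ^ s \<and>
     c * (ln (ln x) ^ k / (x * ln x)) \<le> (1 / 16) ^ s * harm (Suc s) ^ k / real (s + 1)"
\<comment> \<open>The 16 pays for rounding log_16 x up to an integer s, the 3 for s + 1 \<le> 3 ln
  x, and each 4 for bounding ln (ln x) by four times the harmonic number at s + 1.\<close>
proof (intro exI[of _ "1 / (16 * 3 * 4 ^ k)"] conjI allI impI)
  show "1 / (16 * 3 * 4 ^ k) > (0::real)" by simp
  fix x :: real assume x: "x \<ge> 3"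
  have lx: "ln x > 1" using ln_ge_1_if_ge_3[OF x] .
  have l16: "ln (16::real) = 4 * ln 2" using ln_realpow[of 2 4] by simp
  have l16': "1 \<le> ln (16::real)" using l16 ln2_ge_two_thirds by linarith
  have l16u: "ln (16::real) \<le> 4"
    using l16 ln_le_minus_one[of 2] by simp
  define y where "y = log 16 x"
  have ly: "ln x = ln 16 * y" using l16' by (simp add: y_def log_def)
  have y0: "y > 0" using ly lx l16' by (metis less_trans zero_less_one zero_less_mult_pos less_le_trans)
  define s where "s = nat \<lceil>y\<rceil>"
  have s: "y \<le> real s" "real s \<le> y + 1" using y0 by (auto simp: s_def)
  have yl: "y \<le> ln x" using mult_right_mono[OF l16', of y] ly y0 by simp
  have yu: "ln x \<le> 4 * y" using mult_right_mono[OF l16u, of y] ly y0 by simp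
  show "\<exists>s. x \<le> 16 ^ s \<and>
     1 / (16 * 3 * 4 ^ k) * (ln (ln x) ^ k / (x * ln x)) \<le> (1 / 16) ^ s * harm (Suc s) ^ k / real (s + 1)"
  proof (intro exI[of _ s] conjI)
    have "x = 16 powr y" using x by (simp add: y_def)
    also have "\<dots> \<le> 16 powr real s" using s by simp
    finally show "x \<le> 16 ^ s" by (simp add: powr_realpow)
    have "(16::real) ^ s = 16 powr real s" by (simp add: powr_realpow)
    also have "\<dots> \<le> 16 powr (y + 1)" using s by simp
    also have "\<dots> = 16 * x" using x by (simp add: powr_add y_def)
    finally have 1: "1 / (16 * x) \<le> (1 / 16) ^ s" using x by (simp add: field_simps power_one_over)
    have "real (s + 1) \<le> 3 * ln x" using s yl lx by simp
    then have 2: "1 / (3 * ln x) \<le> 1 / real (s + 1)" using lx by (simp add: field_simps)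
    have "ln (ln x) \<le> ln (4 * real (Suc s))" using yu s lx by (intro ln_mono) auto
    also have "\<dots> = ln 4 + ln (real (Suc s))" by (subst ln_mult) auto
    also have "\<dots> \<le> 3 * harm (Suc s) + harm (Suc s)"
    proof (rule add_mono)
      have "ln (4::real) \<le> 3" using ln_le_minus_one[of 4] by simp
      then show "ln 4 \<le> 3 * (harm (Suc s)::real)" using harm_ge_1[of s] by linarith
      have "ln (real (Suc s)) \<le> ln (real (Suc s) + 1)" by simp
      then show "ln (real (Suc s)) \<le> harm (Suc s)" using ln_le_harm[of "Suc s"] by linarith
    qed
    finally have "ln (ln x) \<le> 4 * harm (Suc s)" by simp
    then have "ln (ln x) / 4 \<le> harm (Suc s)" by simp
    then have 3: "(ln (ln x) / 4) ^ k \<le> harm (Suc s) ^ k" using lx by (intro power_mono) auto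
    have "1 / (16 * 3 * 4 ^ k) * (ln (ln x) ^ k / (x * ln x)) = 1 / (16 * x) * (ln (ln x) / 4) ^ k * (1 / (3 * ln x))"
      by (simp add: power_divide)
    also have "\<dots> \<le> (1 / 16) ^ s * harm (Suc s) ^ k * (1 / real (s + 1))"
      using lx x by (intro mult_mono 1 2 3 mult_nonneg_nonneg zero_le_power harm_nonneg) auto
    finally show "1 / (16 * 3 * 4 ^ k) * (ln (ln x) ^ k / (x * ln x)) \<le> (1 / 16) ^ s * harm (Suc s) ^ k / real (s + 1)"
      by simp
  qed
qed

subsection \<open>Conditional laws of the Gauss map\<close>

definition first_digit :: "real \<Rightarrow> nat" where
  "first_digit x = nat \<lfloor>1 / x\<rfloor>"

lemma cf_digit_eq_first_digit: "cf_digit n x = first_digit ((gauss_map ^^ (n - 1)) x)"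
  by (simp add: cf_digit_def first_digit_def)

lemma measurable_gauss_map [measurable]: "gauss_map \<in> borel_measurable borel"
  unfolding gauss_map_def frac_def by measurable

lemma measurable_gauss_map_funpow [measurable]: "(gauss_map ^^ n) \<in> borel_measurable borel"
  by (induction n) (auto intro: measurable_comp[OF _ measurable_gauss_map])

lemma measurable_first_digit [measurable]: "first_digit \<in> measurable borel (count_space UNIV)"
  unfolding first_digit_def by measurable

text \<open>Up to normalisation, \<open>cf_measure s t\<close> with \<open>0 \<le> t \<le> s\<close> is the law of the n-th Gauss iterate
  given the first n digits (take s, t to be the denominators of the last two convergents). Unlike
  Lebesgue measure alone, this family is closed under prescribing one more digit.\<close>

definition cf_measure :: "real \<Rightarrow> real \<Rightarrow> real measure" where
  "cf_measure s t = density lborel (\<lambda>y. ennreal (indicator {0<..<1} y / (s + t * y)\<^sup>2))"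

lemma sets_cf_measure [simp, measurable_cong]: "sets (cf_measure s t) = sets borel"
  and space_cf_measure [simp]: "space (cf_measure s t) = UNIV"
  by (simp_all add: cf_measure_def)

lemma emeasure_cf_measure:
  assumes "A \<in> sets borel"
  shows "emeasure (cf_measure s t) A
    = (\<integral>\<^sup>+y. ennreal (indicator {0<..<1} y / (s + t * y)\<^sup>2) * indicator A y \<partial>lborel)"
  unfolding cf_measure_def using assms by (intro emeasure_density) auto

lemma emeasure_cf_measure_1_0:
  assumes "A \<in> sets borel"
  shows "emeasure (cf_measure 1 0) A = emeasure lborel (A \<inter> {0<..<1})"
proof -
  have "emeasure (cf_measure 1 0) A = (\<integral>\<^sup>+y. indicator (A \<inter> {0<..<1}) y \<partial>lborel)"
    unfolding emeasure_cf_measure[OF assms]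
    by (intro nn_integral_cong) (auto split: split_indicator)
  also have "\<dots> = emeasure lborel (A \<inter> {0<..<1})"
    using assms by (intro nn_integral_indicator) auto
  finally show ?thesis .
qed

text \<open>Trades the digit condition for an interval on which the Gauss map is the smooth branch
  1/x - a, in the shape that integration by substitution expects. The two excluded endpoints form a
  null set.\<close>

lemma gauss_map_branch:
  assumes a: "a \<ge> 1" and x: "x \<noteq> 1 / real a" "x \<noteq> 1 / (real a + 1)"
  shows "(0 < x \<and> x < 1 \<and> first_digit x = a \<and> gauss_map x \<in> H) \<longleftrightarrow>
    (1 / (real a + 1) \<le> x \<and> x \<le> 1 / real a \<and> 0 < 1 / x - real a \<and> 1 / x - real a < 1 \<and> 1 / x - real a \<in> H)"
    (is "?L \<longleftrightarrow> ?R")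
proof
  assume L: ?L
  then have p: "1 / x > 1" by simp
  from L p have f: "\<lfloor>1 / x\<rfloor> = int a" by (auto simp: first_digit_def)
  then have b: "real a \<le> 1 / x" "1 / x < real a + 1" by linarith+
  have fr: "gauss_map x = 1 / x - real a" using f by (simp add: gauss_map_def frac_def)
  have "real a \<noteq> 1 / x" using x(1) a L by (auto simp: field_simps)
  then show ?R using b L a fr by (auto simp: field_simps)
next
  assume R: ?R
  then have x0: "x > 0" using a by (meson divide_pos_pos less_le_trans add_pos_nonneg of_nat_0_le_iff zero_less_one
     add_nonneg_pos)
  have f: "\<lfloor>1 / x\<rfloor> = int a" using R by linarith
  have "1 / x > 1" using R a by linarith
  then have "x < 1" using x0 by (simp add: field_simps)
  with f x0 R show ?L by (simp add: first_digit_def gauss_map_def frac_def)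
qed

text \<open>Substitute x = 1/(a + y): dx contributes 1/(a + y)^2, and (s + t x)(a + y) = s a + t + s
  y. The new parameters follow the recurrence of the denominators of convergents, q' = a q +
  q_prev.\<close>

lemma emeasure_cf_measure_branch:
  assumes s: "s > 0" and t: "t \<ge> 0" and a: "a \<ge> 1" and H[measurable]: "H \<in> sets borel"
  shows "emeasure (cf_measure s t) {x. first_digit x = a \<and> gauss_map x \<in> H}
    = emeasure (cf_measure (s * real a + t) s) H"
proof -
  define f where "f x = indicator ({0<..<1} \<inter> H) (1 / x - real a) / (s + t * x)\<^sup>2" for x :: real
  \<comment> \<open>The branch y \<mapsto> 1/(a + y) is decreasing, while the substitution rule
    wants an increasing map; hence the minus sign here and the reflection x \<mapsto> -x
    below.\<close>
  define g where "g y = - (1 / (real a + y))" for y :: real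
  have [measurable]: "f \<in> borel_measurable borel" unfolding f_def by measurable
  have a0: "real a > 0" using a by simp
  have g01: "g 0 = - (1 / real a)" "g 1 = - (1 / (real a + 1))" by (simp_all add: g_def)
  have "emeasure (cf_measure s t) {x. first_digit x = a \<and> gauss_map x \<in> H}
    = (\<integral>\<^sup>+x. ennreal (indicator {0<..<1} x / (s + t * x)\<^sup>2)
        * indicator {x. first_digit x = a \<and> gauss_map x \<in> H} x \<partial>lborel)"
    by (intro emeasure_cf_measure) measurable
  also have "\<dots> = (\<integral>\<^sup>+x. ennreal (f x * indicator {1 / (real a + 1)..1 / real a} x) \<partial>lborel)"
    using AE_lborel_singleton[of "1 / real a"] AE_lborel_singleton[of "1 / (real a + 1)"]
  proof (intro nn_integral_cong_AE, eventually_elim)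
    case (elim x)
    from gauss_map_branch[OF a elim(3,4), of H]
    show ?case by (auto simp: f_def split: split_indicator)
  qed
  also have "\<dots> = (\<integral>\<^sup>+x. ennreal (f (- x) * indicator {1 / (real a + 1)..1 / real a} (- x)) \<partial>lborel)"
    by (subst nn_integral_real_affine[where c = "-1" and t = 0]) auto
  also have "\<dots> = (\<integral>\<^sup>+x. ennreal (f (- x) * indicator {g 0..g 1} x) \<partial>lborel)"
    by (intro nn_integral_cong) (auto simp: g01 split: split_indicator)
  also have "\<dots> = (\<integral>\<^sup>+y. ennreal (f (- g y) * (1 / (real a + y)\<^sup>2) * indicator {0..1} y) \<partial>lborel)"
  proof (rule nn_integral_substitution)
    show "set_borel_measurable borel {g 0..g 1} (\<lambda>x. f (- x))"
      unfolding set_borel_measurable_def by measurable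
    show "(g has_real_derivative 1 / (real a + y)\<^sup>2) (at y)" if "y \<in> {0..1}" for y
      unfolding g_def using that a0 by (auto intro!: derivative_eq_intros simp: power2_eq_square)
    show "continuous_on {0..1} (\<lambda>y. 1 / (real a + y)\<^sup>2)"
      using a0 by (auto intro!: continuous_intros)
  qed auto
  also have "\<dots> = (\<integral>\<^sup>+y. ennreal (indicator {0<..<1} y / (s * real a + t + s * y)\<^sup>2) * indicator H y \<partial>lborel)"
  proof (intro nn_integral_cong)
    fix y :: real
    have "f (- g y) * (1 / (real a + y)\<^sup>2) = indicator ({0<..<1} \<inter> H) y / (s * real a + t + s * y)\<^sup>2"
      if "0 < y"
    proof -
      have ay: "real a + y > 0" using that a0 by simp
      have "(s + t * (1 / (real a + y))) * (real a + y) = s * real a + t + s * y"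
        using ay by (simp add: field_simps)
      then have "(s + t * (1 / (real a + y)))\<^sup>2 * (real a + y)\<^sup>2 = (s * real a + t + s * y)\<^sup>2"
        by (simp only: power_mult_distrib[symmetric])
      then show ?thesis using ay by (simp add: f_def g_def)
    qed
    moreover have "f (- g y) = 0" if "y = 0" using that a0 by (simp add: f_def g_def)
    ultimately show "ennreal (f (- g y) * (1 / (real a + y)\<^sup>2) * indicator {0..1} y)
      = ennreal (indicator {0<..<1} y / (s * real a + t + s * y)\<^sup>2) * indicator H y"
      by (cases "y \<le> 0") (auto split: split_indicator)
  qed
  also have "\<dots> = emeasure (cf_measure (s * real a + t) s) H"
    by (rule emeasure_cf_measure[symmetric]) simp
  finally show ?thesis .
qed

lemma emeasure_cf_measure_bounds:
  assumes s: "s > 0" and t: "t \<ge> 0" and A[measurable]: "A \<in> sets borel"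
  shows "emeasure (cf_measure s t) A \<le> ennreal (1 / s\<^sup>2) * emeasure (cf_measure 1 0) A"
    and "ennreal (1 / (s + t)\<^sup>2) * emeasure (cf_measure 1 0) A \<le> emeasure (cf_measure s t) A"
proof -
  have b: "1 / (s + t)\<^sup>2 \<le> 1 / (s + t * y)\<^sup>2" "1 / (s + t * y)\<^sup>2 \<le> 1 / s\<^sup>2" if "0 < y" "y < 1" for y
  proof -
    have y: "0 \<le> t * y" "t * y \<le> t" using that t by (auto simp: mult_left_le)
    show "1 / (s + t)\<^sup>2 \<le> 1 / (s + t * y)\<^sup>2" "1 / (s + t * y)\<^sup>2 \<le> 1 / s\<^sup>2"
      using s t y by (auto intro!: divide_left_mono power_mono mult_pos_pos zero_less_power simp: add_pos_nonneg)
  qed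
  have e: "ennreal c * emeasure (cf_measure 1 0) A
      = (\<integral>\<^sup>+y. ennreal c * (ennreal (indicator {0<..<1} y / (1 + 0 * y)\<^sup>2) * indicator A y) \<partial>lborel)" for c
    unfolding emeasure_cf_measure[OF A] by (intro nn_integral_cmult[symmetric]) measurable
  show "emeasure (cf_measure s t) A \<le> ennreal (1 / s\<^sup>2) * emeasure (cf_measure 1 0) A"
    unfolding e unfolding emeasure_cf_measure[OF A]
    using b(2) by (intro nn_integral_mono) (auto split: split_indicator intro!: ennreal_leI)
  show "ennreal (1 / (s + t)\<^sup>2) * emeasure (cf_measure 1 0) A \<le> emeasure (cf_measure s t) A"
    unfolding e unfolding emeasure_cf_measure[OF A]
    using b(1) by (intro nn_integral_mono) (auto split: split_indicator intro!: ennreal_leI)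
qed

lemma finite_measure_cf_measure:
  assumes "s > 0" "t \<ge> 0"
  shows "finite_measure (cf_measure s t)"
proof
  have "emeasure (cf_measure s t) UNIV \<le> ennreal (1 / s\<^sup>2) * emeasure (cf_measure 1 0) UNIV"
    by (rule emeasure_cf_measure_bounds(1)) (use assms in auto)
  also have "\<dots> < \<infinity>" by (simp add: emeasure_cf_measure_1_0 ennreal_mult_less_top)
  finally show "emeasure (cf_measure s t) (space (cf_measure s t)) \<noteq> \<infinity>" by simp
qed

definition cfm :: "real \<Rightarrow> real \<Rightarrow> real set \<Rightarrow> real" where
  "cfm s t A = measure (cf_measure s t) A"

lemma cfm_nonneg [simp]: "cfm s t A \<ge> 0"
  by (simp add: cfm_def)

lemma emeasure_eq_cfm: "s > 0 \<Longrightarrow> t \<ge> 0 \<Longrightarrow> emeasure (cf_measure s t) A = ennreal (cfm s t A)"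
  unfolding cfm_def by (intro finite_measure.emeasure_eq_measure finite_measure_cf_measure)

lemma cfm_1_0_UNIV [simp]: "cfm 1 0 UNIV = 1"
  by (simp add: cfm_def measure_def emeasure_cf_measure_1_0)

lemma cfm_bounds:
  assumes "s > 0" "t \<ge> 0" "A \<in> sets borel"
  shows "cfm s t A \<le> cfm 1 0 A / s\<^sup>2" "cfm 1 0 A / (s + t)\<^sup>2 \<le> cfm s t A"
proof -
  have "ennreal (cfm s t A) \<le> ennreal (1 / s\<^sup>2 * cfm 1 0 A)"
    using emeasure_cf_measure_bounds(1)[OF assms] assms
    by (subst ennreal_mult) (auto simp: emeasure_eq_cfm)
  then show "cfm s t A \<le> cfm 1 0 A / s\<^sup>2" by (subst (asm) ennreal_le_iff) auto
  have "ennreal (1 / (s + t)\<^sup>2 * cfm 1 0 A) \<le> ennreal (cfm s t A)"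
    using emeasure_cf_measure_bounds(2)[OF assms] assms
    by (subst ennreal_mult) (auto simp: emeasure_eq_cfm)
  then show "cfm 1 0 A / (s + t)\<^sup>2 \<le> cfm s t A" by (subst (asm) ennreal_le_iff) auto
qed

lemma cfm_branch:
  assumes "s > 0" "t \<ge> 0" "a \<ge> 1" "H \<in> sets borel"
  shows "cfm s t {x. first_digit x = a \<and> gauss_map x \<in> H} = cfm (s * real a + t) s H"
  using emeasure_cf_measure_branch[OF assms] by (simp add: cfm_def measure_def)

lemma cfm_UNIV_bounds:
  assumes "s > 0" "t \<ge> 0" "t \<le> s"
  shows "1 / (4 * s\<^sup>2) \<le> cfm s t UNIV" "cfm s t UNIV \<le> 1 / s\<^sup>2"
proof -
  have "(s + t)\<^sup>2 \<le> (2 * s)\<^sup>2" using assms by (intro power_mono) auto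
  then have "1 / (4 * s\<^sup>2) \<le> 1 / (s + t)\<^sup>2"
    using assms by (intro divide_left_mono mult_pos_pos zero_less_power) (auto simp: power_mult_distrib)
  also have "\<dots> \<le> cfm s t UNIV" using cfm_bounds(2)[of s t UNIV] assms by simp
  finally show "1 / (4 * s\<^sup>2) \<le> cfm s t UNIV" .
  show "cfm s t UNIV \<le> 1 / s\<^sup>2" using cfm_bounds(1)[of s t UNIV] assms by simp
qed

text \<open>The density varies by at most ((s + t)/s)^2 \<le> 4 on the unit interval. As the
  parameters carry all that the past can influence, this is the substitute for independence.\<close>

lemma cfm_distortion:
  assumes "s > 0" "t \<ge> 0" "t \<le> s" "A \<in> sets borel"
  shows "cfm s t A \<le> 4 * cfm 1 0 A * cfm s t UNIV" "cfm 1 0 A / 4 * cfm s t UNIV \<le> cfm s t A"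
proof -
  note b = cfm_UNIV_bounds[OF assms(1-3)]
  have "cfm s t A \<le> 4 * cfm 1 0 A * (1 / (4 * s\<^sup>2))"
    using cfm_bounds(1)[of s t A] assms by simp
  also have "\<dots> \<le> 4 * cfm 1 0 A * cfm s t UNIV" by (intro mult_left_mono b) auto
  finally show "cfm s t A \<le> 4 * cfm 1 0 A * cfm s t UNIV" .
  have "cfm 1 0 A / 4 * cfm s t UNIV \<le> cfm 1 0 A / 4 * (1 / s\<^sup>2)" by (intro mult_left_mono b) auto
  also have "\<dots> = cfm 1 0 A / (2 * s)\<^sup>2" by (simp add: power_mult_distrib)
  also have "\<dots> \<le> cfm 1 0 A / (s + t)\<^sup>2"
    using assms by (intro divide_left_mono power_mono mult_pos_pos zero_less_power) auto
  also have "\<dots> \<le> cfm s t A" using cfm_bounds(2)[of s t A] assms by simp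
  finally show "cfm 1 0 A / 4 * cfm s t UNIV \<le> cfm s t A" .
qed

text \<open>Relative to the total mass, this is the conditional probability that the next digit is
  a. The 4 is the lower bound 1/(4 s^2) of the total mass; the 9 is the square in s a + t + s \<le>
  3 s a, which holds by t \<le> s and a \<ge> 1.\<close>

lemma cfm_digit_bounds:
  assumes "s > 0" "t \<ge> 0" "t \<le> s" "a \<ge> 1"
  shows "cfm (s * real a + t) s UNIV \<le> 4 / (real a)\<^sup>2 * cfm s t UNIV"
    and "1 / (9 * (real a)\<^sup>2) * cfm s t UNIV \<le> cfm (s * real a + t) s UNIV"
proof -
  note b = cfm_UNIV_bounds[OF assms(1-3)]
  have a: "real a \<ge> 1" using assms by simp
  have sa: "s * real a > 0" using a assms by simp
  have "cfm (s * real a + t) s UNIV \<le> 1 / (s * real a + t)\<^sup>2"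
    using cfm_bounds(1)[of "s * real a + t" s UNIV] assms add_pos_nonneg[OF sa assms(2)] by simp
  also have "\<dots> \<le> 1 / (s * real a)\<^sup>2"
    using assms sa add_pos_nonneg[OF sa assms(2)]
    by (intro divide_left_mono power_mono mult_pos_pos zero_less_power) auto
  also have "\<dots> = 4 / (real a)\<^sup>2 * (1 / (4 * s\<^sup>2))" by (simp add: power_mult_distrib)
  also have "\<dots> \<le> 4 / (real a)\<^sup>2 * cfm s t UNIV" by (intro mult_left_mono b) auto
  finally show "cfm (s * real a + t) s UNIV \<le> 4 / (real a)\<^sup>2 * cfm s t UNIV" .
  have "1 / (9 * (real a)\<^sup>2) * cfm s t UNIV \<le> 1 / (9 * (real a)\<^sup>2) * (1 / s\<^sup>2)"
    by (intro mult_left_mono b) auto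
  also have "\<dots> = 1 / (3 * (s * real a))\<^sup>2" by (simp add: power_mult_distrib)
  also have "\<dots> \<le> 1 / (s * real a + t + s)\<^sup>2"
  proof (intro divide_left_mono power_mono mult_pos_pos zero_less_power)
    have "s * 1 \<le> s * real a" using a assms by (intro mult_left_mono) auto
    then show "s * real a + t + s \<le> 3 * (s * real a)" using assms(1-3) by linarith
    show "0 < s * real a + t + s" using sa assms(1,2) by linarith
  qed (use assms sa in auto)
  also have "\<dots> \<le> cfm (s * real a + t) s UNIV"
    using cfm_bounds(2)[of "s * real a + t" s UNIV] assms add_pos_nonneg[OF sa assms(2)] by simp
  finally show "1 / (9 * (real a)\<^sup>2) * cfm s t UNIV \<le> cfm (s * real a + t) s UNIV" .
qed

text \<open>The invariant 0 \<le> t \<le> s survives reading a digit, so inductive hypotheses apply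
  to the new parameters.\<close>

lemma branch_params:
  fixes s t :: real
  assumes "s > 0" "t \<ge> 0" "t \<le> s" "a \<ge> 1"
  shows "s * real a + t > 0" "s \<ge> 0" "s \<le> s * real a + t"
proof -
  have "s * 1 \<le> s * real a" using assms by (intro mult_left_mono) auto
  then show "s \<le> s * real a + t" "s * real a + t > 0" "s \<ge> 0" using assms by linarith+
qed

section \<open>Conditioning on finitely many digits\<close>

fun digits :: "nat \<Rightarrow> real \<Rightarrow> nat list" where
  "digits 0 x = []"
| "digits (Suc m) x = first_digit x # digits m (gauss_map x)"

text \<open>There are only countably many digit lists, so an arbitrary predicate on them is a Borel
  event. This is why the past is encoded as a list: no measurability condition on \<open>P\<close>
  has to be carried along when the first digit is peeled off.\<close>

lemma sets_digits [measurable]: "{x. P (digits m x)} \<in> sets borel"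
proof (induction m arbitrary: P)
  case (Suc m)
  have "{x. P (digits (Suc m) x)}
      = (\<Union>a. {x. first_digit x = a \<and> gauss_map x \<in> {y. P (a # digits m y)}})" by auto
  moreover have "{x. first_digit x = a \<and> gauss_map x \<in> {y. P (a # digits m y)}} \<in> sets borel" for a
    using Suc[of "\<lambda>ds. P (a # ds)"] by measurable
  ultimately show ?case by simp
qed simp

text \<open>The law of total probability with respect to the first digit. The digit 0 occurs only
  outside (0,1), where there is no mass, so the sum starts at digit 1.\<close>

lemma cfm_sums_branches:
  assumes s: "s > 0" and t: "t \<ge> 0" and Y: "\<And>a. Y a \<in> sets borel"
  shows "(\<lambda>a. cfm (s * real (Suc a) + t) s (Y (Suc a))) sums cfm s t {x. gauss_map x \<in> Y (first_digit x)}"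
proof -
  interpret finite_measure "cf_measure s t" by (rule finite_measure_cf_measure[OF s t])
  let ?A = "\<lambda>a. {x. first_digit x = Suc a \<and> gauss_map x \<in> Y (Suc a)}"
  have A: "?A a \<in> sets borel" for a using Y[of "Suc a"] by measurable
  have B: "{x. first_digit x = 0 \<and> gauss_map x \<in> Y 0} \<in> sets borel" using Y[of 0] by measurable
  have "{x. gauss_map x \<in> Y (first_digit x)} = (\<Union>a. ?A a) \<union> {x. first_digit x = 0 \<and> gauss_map x \<in> Y 0}"
  proof (intro set_eqI)
    fix x show "x \<in> {x. gauss_map x \<in> Y (first_digit x)} \<longleftrightarrow>
      x \<in> (\<Union>a. ?A a) \<union> {x. first_digit x = 0 \<and> gauss_map x \<in> Y 0}"
      by (cases "first_digit x") auto
  qed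
  moreover have "measure (cf_measure s t) ((\<Union>a. ?A a) \<union> {x. first_digit x = 0 \<and> gauss_map x \<in> Y 0})
      = measure (cf_measure s t) (\<Union>a. ?A a)"
  proof (rule measure_Un_null_set)
    have "emeasure (cf_measure s t) {x. first_digit x = 0 \<and> gauss_map x \<in> Y 0} = 0"
    proof -
      have "(first_digit x = 0) \<longrightarrow> x \<notin> {0<..<1}" for x
      proof -
        have "1 / x > 1" if "0 < x" "x < 1" using that by simp
        then have "\<lfloor>1 / x\<rfloor> \<ge> 1" if "0 < x" "x < 1" using that by (simp add: le_floor_iff)
        then show ?thesis by (fastforce simp: first_digit_def)
      qed
      then have "(\<integral>\<^sup>+y. ennreal (indicator {0<..<1} y / (s + t * y)\<^sup>2)
          * indicator {x. first_digit x = 0 \<and> gauss_map x \<in> Y 0} y \<partial>lborel) = (\<integral>\<^sup>+(y::real). 0 \<partial>lborel)"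
        by (intro nn_integral_cong) (auto split: split_indicator)
      then show ?thesis using emeasure_cf_measure[OF B] by simp
    qed
    then show "{x. first_digit x = 0 \<and> gauss_map x \<in> Y 0} \<in> null_sets (cf_measure s t)"
      using B by (simp add: null_sets_def)
  qed (use A in auto)
  moreover have "(\<lambda>a. measure (cf_measure s t) (?A a)) sums measure (cf_measure s t) (\<Union>a. ?A a)"
    using A by (intro finite_measure_UNION) (auto simp: disjoint_family_on_def)
  ultimately show ?thesis
    using cfm_branch[OF s t _ Y, of "Suc _"] by (simp add: cfm_def)
qed

text \<open>A bound that is uniform in the family of measures survives conditioning on any event in the
  preceding digits; this replaces independence.\<close>

lemma cfm_digits_then:
  assumes H: "H \<in> sets borel" and c: "c \<ge> 0"
    and le: "\<And>s t. s > 0 \<Longrightarrow> t \<ge> 0 \<Longrightarrow> t \<le> s \<Longrightarrow> cfm s t H \<le> c * cfm s t UNIV"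
    and st: "s > 0" "t \<ge> 0" "t \<le> s"
  shows "cfm s t {x. P (digits m x) \<and> (gauss_map ^^ m) x \<in> H} \<le> c * cfm s t {x. P (digits m x)}"
  using st
proof (induction m arbitrary: P s t)
  case 0
  then show ?case using le[OF 0] by (cases "P []") (auto simp: cfm_def)
next
  case (Suc m)
  let ?Y = "\<lambda>a. {y. P (a # digits m y) \<and> (gauss_map ^^ m) y \<in> H}"
  let ?Z = "\<lambda>a. {y. P (a # digits m y)}"
  have Z: "?Z a \<in> sets borel" for a by (rule sets_digits)
  have Y: "?Y a \<in> sets borel" for a
  proof -
    have "?Y a = ?Z a \<inter> (gauss_map ^^ m) -` H" by auto
    moreover have "(gauss_map ^^ m) -` H \<in> sets borel"
      using measurable_sets[OF measurable_gauss_map_funpow H] by simp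
    ultimately show ?thesis using Z by simp
  qed
  have 1: "(\<lambda>a. cfm (s * real (Suc a) + t) s (?Y (Suc a))) sums
      cfm s t {x. P (digits (Suc m) x) \<and> (gauss_map ^^ Suc m) x \<in> H}"
    using cfm_sums_branches[OF Suc.prems(1,2) Y] by (simp add: funpow_Suc_right del: funpow.simps)
  have 2: "(\<lambda>a. cfm (s * real (Suc a) + t) s (?Z (Suc a))) sums cfm s t {x. P (digits (Suc m) x)}"
    using cfm_sums_branches[OF Suc.prems(1,2) Z] by simp
  show ?case
  proof (rule sums_le[OF _ 1 sums_mult[OF 2]])
    fix a
    show "cfm (s * real (Suc a) + t) s (?Y (Suc a)) \<le> c * cfm (s * real (Suc a) + t) s (?Z (Suc a))"
      using branch_params[OF Suc.prems, of "Suc a"] by (intro Suc.IH) auto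
  qed
qed

section \<open>Digits in blocks with a prescribed total level\<close>

fun level_set :: "(nat \<Rightarrow> nat set) \<Rightarrow> nat \<Rightarrow> nat \<Rightarrow> real set" where
  "level_set Q 0 n = (if n = 0 then UNIV else {})"
| "level_set Q (Suc l) n = {x. \<exists>j\<le>n. first_digit x \<in> Q j \<and> gauss_map x \<in> level_set Q l (n - j)}"

lemma level_set_Suc:
  "level_set Q (Suc l) n = (\<Union>(j, a)\<in>(SIGMA j:{..n}. Q j).
     {x. first_digit x = a \<and> gauss_map x \<in> level_set Q l (n - j)})"
  by auto

lemma sets_level_set [measurable]: "level_set Q l n \<in> sets borel"
proof (induction l arbitrary: n)
  case (Suc l)
  have "{x. first_digit x \<in> Q j \<and> gauss_map x \<in> level_set Q l (n - j)} \<in> sets borel" for j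
    using Suc[of "n - j"] by measurable
  moreover have "level_set Q (Suc l) n
      = (\<Union>j\<in>{..n}. {x. first_digit x \<in> Q j \<and> gauss_map x \<in> level_set Q l (n - j)})" by auto
  ultimately show ?case by (metis (no_types, lifting) sets.finite_UN finite_atMost)
qed simp

text \<open>\<open>level_set\<close> and \<open>harmonic_conv\<close> obey the same recursion.
  Splitting off a first digit in block j contributes C r^j / (j + 1); the powers of r combine to r^n
  and the weights 1/(j + 1) form the next convolution. Generality in s and t lets the hypothesis be
  used behind every digit.\<close>

lemma cfm_level_set_upper:
  assumes Q: "\<And>j. finite (Q j)" "\<And>j. 0 \<notin> Q j"
    and C: "C \<ge> 0" "r \<ge> 0"
    and le: "\<And>j. (\<Sum>a\<in>Q j. 4 / (real a)\<^sup>2) \<le> C * r ^ j / real (j + 1)"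
    and st: "s > 0" "t \<ge> 0" "t \<le> s"
  shows "cfm s t (level_set Q l n) \<le> C ^ l * r ^ n * harmonic_conv l n * cfm s t UNIV"
  using st
proof (induction l arbitrary: s t n)
  case 0
  then show ?case by (auto simp: cfm_def)
next
  case (Suc l)
  interpret finite_measure "cf_measure s t" by (rule finite_measure_cf_measure[OF Suc.prems(1,2)])
  define B where "B j a = {x. first_digit x = a \<and> gauss_map x \<in> level_set Q l (n - j)}" for j a
  have B: "B j a \<in> sets borel" for j a unfolding B_def by measurable
  define I where "I = (SIGMA j:{..n}. Q j)"
  have fI: "finite I" unfolding I_def using Q by auto
  define K where "K j = C ^ l * r ^ (n - j) * harmonic_conv l (n - j)" for j
  have K: "K j \<ge> 0" for j unfolding K_def using C harmonic_conv_nonneg by simp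
  have Bm: "cfm s t (B j a) \<le> K j * (4 / (real a)\<^sup>2) * cfm s t UNIV" if "a \<in> Q j" for j a
  proof -
    have a: "a \<ge> 1" using that Q(2)[of j] by (metis One_nat_def Suc_leI neq0_conv)
    have "cfm s t (B j a) = cfm (s * real a + t) s (level_set Q l (n - j))"
      unfolding B_def using Suc.prems a by (intro cfm_branch) auto
    also have "\<dots> \<le> K j * cfm (s * real a + t) s UNIV"
      unfolding K_def using branch_params[OF Suc.prems a] by (intro Suc.IH)
    also have "\<dots> \<le> K j * (4 / (real a)\<^sup>2 * cfm s t UNIV)"
      by (intro mult_left_mono cfm_digit_bounds Suc.prems a K)
    finally show ?thesis by simp
  qed
  have "cfm s t (level_set Q (Suc l) n) = measure (cf_measure s t) (\<Union>p\<in>I. B (fst p) (snd p))"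
    unfolding level_set_Suc cfm_def I_def B_def by (rule arg_cong[where f = "measure _"]) auto
  also have "\<dots> \<le> (\<Sum>p\<in>I. cfm s t (B (fst p) (snd p)))"
    unfolding cfm_def by (rule finite_measure_subadditive_finite) (use fI B in auto)
  also have "\<dots> = (\<Sum>j\<le>n. \<Sum>a\<in>Q j. cfm s t (B j a))"
    unfolding I_def by (subst sum.Sigma) (use Q in \<open>auto intro!: sum.cong\<close>)
  also have "\<dots> \<le> (\<Sum>j\<le>n. C ^ Suc l * r ^ n * cfm s t UNIV * (harmonic_conv l (n - j) / real (j + 1)))"
  proof (rule sum_mono)
    fix j assume j: "j \<in> {..n}"
    have "(\<Sum>a\<in>Q j. cfm s t (B j a)) \<le> (\<Sum>a\<in>Q j. K j * (4 / (real a)\<^sup>2) * cfm s t UNIV)"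
      by (intro sum_mono Bm)
    also have "\<dots> = K j * (\<Sum>a\<in>Q j. 4 / (real a)\<^sup>2) * cfm s t UNIV"
      by (simp only: sum_distrib_left sum_distrib_right)
    also have "\<dots> \<le> K j * (C * r ^ j / real (j + 1)) * cfm s t UNIV"
      by (intro mult_right_mono mult_left_mono le K) auto
    also have "\<dots> = C ^ Suc l * (r ^ (n - j) * r ^ j) * cfm s t UNIV * (harmonic_conv l (n - j) / real (j + 1))"
      by (simp add: K_def)
    also have "r ^ (n - j) * r ^ j = r ^ n" using j by (simp flip: power_add)
    finally show "(\<Sum>a\<in>Q j. cfm s t (B j a))
      \<le> C ^ Suc l * r ^ n * cfm s t UNIV * (harmonic_conv l (n - j) / real (j + 1))" .
  qed
  also have "\<dots> = C ^ Suc l * r ^ n * harmonic_conv (Suc l) n * cfm s t UNIV"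
    by (simp only: sum_distrib_left[symmetric] harmonic_conv.simps mult_ac)
  finally show ?case .
qed

text \<open>The same recursion, with additivity in place of subadditivity: the blocks are disjoint,
  so the first digit determines its block and the pieces do not overlap.\<close>

lemma cfm_level_set_lower:
  assumes Q: "\<And>j. finite (Q j)" "\<And>j. 0 \<notin> Q j" "\<And>i j. i \<noteq> j \<Longrightarrow> Q i \<inter> Q j = {}"
    and C: "C \<ge> 0" "r \<ge> 0"
    and le: "\<And>j. C * r ^ j / real (j + 1) \<le> (\<Sum>a\<in>Q j. 1 / (9 * (real a)\<^sup>2))"
    and st: "s > 0" "t \<ge> 0" "t \<le> s"
  shows "C ^ l * r ^ n * harmonic_conv l n * cfm s t UNIV \<le> cfm s t (level_set Q l n)"
  using st
proof (induction l arbitrary: s t n)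
  case 0
  then show ?case by (auto simp: cfm_def)
next
  case (Suc l)
  interpret finite_measure "cf_measure s t" by (rule finite_measure_cf_measure[OF Suc.prems(1,2)])
  define B where "B j a = {x. first_digit x = a \<and> gauss_map x \<in> level_set Q l (n - j)}" for j a
  have B: "B j a \<in> sets borel" for j a unfolding B_def by measurable
  define I where "I = (SIGMA j:{..n}. Q j)"
  have fI: "finite I" unfolding I_def using Q by auto
  define K where "K j = C ^ l * r ^ (n - j) * harmonic_conv l (n - j)" for j
  have K: "K j \<ge> 0" for j unfolding K_def using C harmonic_conv_nonneg by simp
  have Bm: "K j * (1 / (9 * (real a)\<^sup>2)) * cfm s t UNIV \<le> cfm s t (B j a)" if "a \<in> Q j" for j a
  proof -
    have a: "a \<ge> 1" using that Q(2)[of j] by (metis One_nat_def Suc_leI neq0_conv)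
    have "K j * (1 / (9 * (real a)\<^sup>2)) * cfm s t UNIV = K j * (1 / (9 * (real a)\<^sup>2) * cfm s t UNIV)" by simp
    also have "\<dots> \<le> K j * cfm (s * real a + t) s UNIV"
      by (intro mult_left_mono cfm_digit_bounds Suc.prems a K)
    also have "\<dots> \<le> cfm (s * real a + t) s (level_set Q l (n - j))"
      unfolding K_def using branch_params[OF Suc.prems a] by (intro Suc.IH)
    also have "\<dots> = cfm s t (B j a)"
      unfolding B_def using Suc.prems a by (intro cfm_branch[symmetric]) auto
    finally show ?thesis .
  qed
  have "C ^ Suc l * r ^ n * harmonic_conv (Suc l) n * cfm s t UNIV
      = (\<Sum>j\<le>n. C ^ Suc l * r ^ n * cfm s t UNIV * (harmonic_conv l (n - j) / real (j + 1)))"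
    by (simp only: sum_distrib_left[symmetric] harmonic_conv.simps mult_ac)
  also have "\<dots> \<le> (\<Sum>j\<le>n. \<Sum>a\<in>Q j. cfm s t (B j a))"
  proof (rule sum_mono)
    fix j assume j: "j \<in> {..n}"
    have "r ^ n = r ^ (n - j) * r ^ j" using j by (simp flip: power_add)
    then have "C ^ Suc l * r ^ n * cfm s t UNIV * (harmonic_conv l (n - j) / real (j + 1))
        = K j * (C * r ^ j / real (j + 1)) * cfm s t UNIV"
      by (simp add: K_def)
    also have "\<dots> \<le> K j * (\<Sum>a\<in>Q j. 1 / (9 * (real a)\<^sup>2)) * cfm s t UNIV"
      by (intro mult_right_mono mult_left_mono le K) auto
    also have "\<dots> = (\<Sum>a\<in>Q j. K j * (1 / (9 * (real a)\<^sup>2)) * cfm s t UNIV)"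
      by (simp only: sum_distrib_left sum_distrib_right)
    also have "\<dots> \<le> (\<Sum>a\<in>Q j. cfm s t (B j a))"
      by (intro sum_mono Bm)
    finally show "C ^ Suc l * r ^ n * cfm s t UNIV * (harmonic_conv l (n - j) / real (j + 1))
      \<le> (\<Sum>a\<in>Q j. cfm s t (B j a))" .
  qed
  also have "\<dots> = (\<Sum>p\<in>I. cfm s t (B (fst p) (snd p)))"
    unfolding I_def by (subst sum.Sigma) (use Q in \<open>auto intro!: sum.cong\<close>)
  also have "\<dots> = measure (cf_measure s t) (\<Union>p\<in>I. B (fst p) (snd p))"
    unfolding cfm_def
  proof (rule finite_measure_finite_Union[symmetric])
    show "disjoint_family_on (\<lambda>p. B (fst p) (snd p)) I"
      using Q(3) unfolding disjoint_family_on_def I_def B_def by fastforce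
  qed (use fI B in auto)
  also have "\<dots> = cfm s t (level_set Q (Suc l) n)"
    unfolding level_set_Suc cfm_def I_def B_def by (rule arg_cong[where f = "measure _"]) auto
  finally show ?case .
qed

subsection \<open>Products of consecutive prime digits\<close>

definition dyadic_primes :: "nat \<Rightarrow> nat set" where
  "dyadic_primes j = {p. prime p \<and> 2 ^ j \<le> p \<and> p < 2 ^ Suc j}"

text \<open>The cruder base 16 absorbs the gap between the constants in the two Chebyshev bounds, so that
  every block is provably rich in primes.\<close>

definition hexadic_primes :: "nat \<Rightarrow> nat set" where
  "hexadic_primes j = {p. prime p \<and> 16 ^ (j + 1) < p \<and> p \<le> 16 ^ (j + 2)}"

lemma finite_dyadic_primes: "finite (dyadic_primes j)"
  unfolding dyadic_primes_def by (rule finite_subset[of _ "{..2 ^ Suc j}"]) auto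

lemma finite_hexadic_primes: "finite (hexadic_primes j)"
  unfolding hexadic_primes_def by (rule finite_subset[of _ "{..16 ^ (j + 2)}"]) auto

lemma hexadic_primes_disjoint:
  assumes "i \<noteq> j"
  shows "hexadic_primes i \<inter> hexadic_primes j = {}"
proof -
  have "hexadic_primes i \<inter> hexadic_primes j = {}" if "i < j" for i j
  proof -
    have "(16::nat) ^ (i + 2) \<le> 16 ^ (j + 1)" using that by (intro power_increasing) auto
    then show ?thesis by (auto simp: hexadic_primes_def)
  qed
  then show ?thesis using assms by (metis inf_commute nat_neq_iff)
qed

lemma sum_dyadic_primes_upper:
  "(\<Sum>a\<in>dyadic_primes j. 4 / (real a)\<^sup>2) \<le> 20 * (1 / 2) ^ j / real (j + 1)"
proof -
  have "(\<Sum>a\<in>dyadic_primes j. 4 / (real a)\<^sup>2) \<le> of_nat (card (dyadic_primes j)) * (4 / (2 ^ j)\<^sup>2)"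
  proof (rule sum_bounded_above)
    fix a assume "a \<in> dyadic_primes j"
    then have "2 ^ j \<le> a" by (simp add: dyadic_primes_def)
    then have "2 ^ j \<le> real a" by (metis of_nat_le_iff of_nat_power of_nat_numeral)
    then show "4 / (real a)\<^sup>2 \<le> 4 / (2 ^ j)\<^sup>2"
      by (intro divide_left_mono power_mono mult_pos_pos zero_less_power)
         (auto intro: less_le_trans[of 0 "2 ^ j"])
  qed
  \<comment> \<open>The 20 is 5 * 4: at most 5 * 2^j / (j + 1) primes, each of weight at most 4 /
    4^j.\<close>
  also have "\<dots> \<le> 20 * (1 / 2) ^ j / real (j + 1)"
  proof -
    have "real ((j + 1) * card (dyadic_primes j)) \<le> real (5 * 2 ^ j)"
      unfolding of_nat_le_iff dyadic_primes_def by (rule card_prime_block_upper)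
    then have "real (card (dyadic_primes j)) \<le> 5 * 2 ^ j / real (j + 1)"
      by (simp add: field_simps)
    then have "real (card (dyadic_primes j)) * (4 / (2 ^ j)\<^sup>2) \<le> 5 * 2 ^ j / real (j + 1) * (4 / (2 ^ j)\<^sup>2)"
      by (intro mult_right_mono) auto
    also have "\<dots> = 20 * (1 / 2) ^ j / real (j + 1)"
      by (simp add: power2_eq_square power_one_over)
    finally show ?thesis .
  qed
  finally show ?thesis .
qed

lemma sum_hexadic_primes_lower:
  "1 / (12 * 16 ^ 3) * (1 / 16) ^ j / real (j + 1) \<le> (\<Sum>a\<in>hexadic_primes j. 1 / (9 * (real a)\<^sup>2))"
proof -
  define X :: real where "X = 16 ^ j"
  have X: "X > 0" by (simp add: X_def)
  have "real (3 * 16 ^ (j + 1)) \<le> real (4 * (j + 1) * card (hexadic_primes j))"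
    unfolding of_nat_le_iff hexadic_primes_def by (rule card_prime_block_lower)
  then have "48 * X \<le> 4 * real (j + 1) * real (card (hexadic_primes j))"
    by (simp add: X_def)
  then have c: "12 * X / real (j + 1) \<le> real (card (hexadic_primes j))"
    by (simp add: field_simps)
  \<comment> \<open>At least 12 * 16^j / (j + 1) primes, each at most 16^(j+2) and so of weight at
    least 1 / (9 * 16^(2j+4)); and 12 / (9 * 16^4) = 1 / (12 * 16^3).\<close>
  have "1 / (12 * 16 ^ 3) * (1 / 16) ^ j / real (j + 1) = 12 * X / real (j + 1) * (1 / (9 * (16 ^ 2 * X)\<^sup>2))"
    using X by (simp add: X_def[symmetric] power_one_over power2_eq_square)
  also have "\<dots> \<le> of_nat (card (hexadic_primes j)) * (1 / (9 * (16 ^ 2 * X)\<^sup>2))"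
    using c by (intro mult_right_mono) auto
  also have "\<dots> \<le> (\<Sum>a\<in>hexadic_primes j. 1 / (9 * (real a)\<^sup>2))"
  proof (rule sum_bounded_below)
    fix a assume "a \<in> hexadic_primes j"
    then have a: "a \<le> 16 ^ (j + 2)" "a > 0" by (auto simp: hexadic_primes_def prime_gt_0_nat)
    then have "real a \<le> real (16 ^ (j + 2))" by (simp only: of_nat_le_iff)
    then have "real a \<le> 16 ^ 2 * X" by (simp add: X_def)
    then show "1 / (9 * (16 ^ 2 * X)\<^sup>2) \<le> 1 / (9 * (real a)\<^sup>2)"
      using a X by (intro divide_left_mono mult_left_mono power_mono mult_pos_pos zero_less_power) auto
  qed
  finally show ?thesis .
qed

section \<open>The distribution of the product of the first l prime digits\<close>

definition first_prime_digit :: "real \<Rightarrow> real" where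
  "first_prime_digit x = (if prime (first_digit x) then real (first_digit x) else 0)"

definition block_prod :: "nat \<Rightarrow> real \<Rightarrow> real" where
  "block_prod l x = (\<Prod>i<l. first_prime_digit ((gauss_map ^^ i) x))"

lemma block_prod_0 [simp]: "block_prod 0 x = 1"
  by (simp add: block_prod_def)

lemma block_prod_Suc: "block_prod (Suc l) x = first_prime_digit x * block_prod l (gauss_map x)"
  unfolding block_prod_def prod.lessThan_Suc_shift by (simp add: funpow_Suc_right del: funpow.simps)

lemma block_prod_nonneg: "block_prod l x \<ge> 0"
  unfolding block_prod_def by (intro prod_nonneg) (auto simp: first_prime_digit_def)

lemma measurable_first_prime_digit [measurable]: "first_prime_digit \<in> borel_measurable borel"
  unfolding first_prime_digit_def by measurable

lemma measurable_block_prod [measurable]: "block_prod l \<in> borel_measurable borel"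
  unfolding block_prod_def by measurable

lemma block_prod_eq_digits:
  "block_prod l x = prod_list (map (\<lambda>d. if prime d then real d else 0) (digits l x))"
  by (induction l arbitrary: x) (auto simp: block_prod_Suc first_prime_digit_def)

lemma ex_dyadic_prime_level:
  assumes "prime p"
  obtains j where "p \<in> dyadic_primes j"
proof -
  obtain j where "2 ^ j \<le> p" "p < 2 ^ Suc j"
    using ex_power_ivl1[of 2 p] prime_ge_1_nat[OF assms] by auto
  then show ?thesis using assms that by (auto simp: dyadic_primes_def)
qed

text \<open>A positive product means that all l digits are prime. Each is less than twice the lower
  end of its block, which accounts for the extra 2^l. The weak inequality carries the induction from
  the empty product 1 = 2^0, for which the strict one fails.\<close>

lemma block_prod_in_level_set:
  assumes "block_prod l x > 0"
  shows "\<exists>n. x \<in> level_set dyadic_primes l n \<and> block_prod l x \<le> 2 ^ (n + l) \<and> (l > 0 \<longrightarrow> block_prod l x < 2 ^ (n + l))"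
  using assms
proof (induction l arbitrary: x)
  case 0
  then show ?case by auto
next
  case (Suc l)
  have pos: "first_prime_digit x > 0" "block_prod l (gauss_map x) > 0"
    using Suc.prems block_prod_nonneg[of l "gauss_map x"]
    unfolding block_prod_Suc by (auto simp: zero_less_mult_iff)
  then have p: "prime (first_digit x)" "first_prime_digit x = real (first_digit x)"
    by (auto simp: first_prime_digit_def split: if_splits)
  obtain j where j: "first_digit x \<in> dyadic_primes j" using ex_dyadic_prime_level[OF p(1)] .
  obtain n where n: "gauss_map x \<in> level_set dyadic_primes l n" "block_prod l (gauss_map x) \<le> 2 ^ (n + l)"
    using Suc.IH[OF pos(2)] by blast
  have "first_digit x < 2 ^ Suc j" using j by (simp add: dyadic_primes_def)
  then have "real (first_digit x) < real (2 ^ Suc j)" by (simp only: of_nat_less_iff)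
  then have "first_prime_digit x < 2 ^ Suc j" using p by simp
  then have "block_prod (Suc l) x < 2 ^ Suc j * 2 ^ (n + l)"
    unfolding block_prod_Suc using pos n by (intro mult_less_le_imp_less) auto
  also have "\<dots> = 2 ^ ((j + n) + Suc l)" by (simp add: power_add)
  finally have "block_prod (Suc l) x < 2 ^ ((j + n) + Suc l)" .
  moreover have "x \<in> level_set dyadic_primes (Suc l) (j + n)"
    using j n by (auto intro!: exI[of _ j])
  ultimately show ?case by (intro exI[of _ "j + n"]) auto
qed

lemma block_prod_ge_if_level_set:
  assumes "x \<in> level_set hexadic_primes l n"
  shows "block_prod l x \<ge> 16 ^ n"
  using assms
proof (induction l arbitrary: x n)
  case 0
  then show ?case by (auto split: if_splits)
next
  case (Suc l)
  then obtain j where j: "j \<le> n" "first_digit x \<in> hexadic_primes j" "gauss_map x \<in> level_set hexadic_primes l (n - j)"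
    by auto
  have p: "prime (first_digit x)" "first_digit x > 16 ^ (j + 1)" using j by (auto simp: hexadic_primes_def)
  have "(16::nat) ^ j \<le> 16 ^ (j + 1)" by simp
  then have "16 ^ j \<le> first_digit x" using p by linarith
  then have "real (16 ^ j) \<le> real (first_digit x)" by (simp only: of_nat_le_iff)
  then have "16 ^ j * 16 ^ (n - j) \<le> block_prod (Suc l) x"
    unfolding block_prod_Suc first_prime_digit_def using p Suc.IH[OF j(3)] by (intro mult_mono) auto
  then show ?case using j by (simp flip: power_add)
qed

definition rate :: "nat \<Rightarrow> real \<Rightarrow> real" where
  "rate k x = ln (ln x) ^ k / (x * ln x)"

lemma cfm_mono: 
  assumes "s > 0" "t \<ge> 0" "A \<subseteq> B" "B \<in> sets borel"
  shows "cfm s t A \<le> cfm s t B"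
  unfolding cfm_def using finite_measure.finite_measure_mono[OF finite_measure_cf_measure[OF assms(1,2)] assms(3)] assms
  by simp

lemma block_prod_tail_upper:
  "\<exists>C>0. \<forall>x\<ge>3. cfm 1 0 {y. x \<le> block_prod (Suc k) y} \<le> C * rate k x"
proof -
  obtain C1 where C1: "C1 > 0"
    "\<And>m. summable (\<lambda>i. (1 / 2) ^ (m + i) * harmonic_conv (Suc k) (m + i))"
    "\<And>m. (\<Sum>i. (1 / 2) ^ (m + i) * harmonic_conv (Suc k) (m + i))
       \<le> C1 * ((1 / 2) ^ m * harm (Suc m) ^ k / real (m + 1))"
    using harmonic_conv_tail[of k] by metis
  obtain C2 where C2: "C2 > 0"
    "\<And>x. x \<ge> 3 \<Longrightarrow> (let m = nat \<lfloor>log 2 x\<rfloor> - k in (1 / 2) ^ m * harm (Suc m) ^ k / real (m + 1)) \<le> C2 * rate k x"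
    using dyadic_rate_upper[of k] unfolding rate_def Let_def by metis
  interpret finite_measure "cf_measure 1 0" by (rule finite_measure_cf_measure) auto
  show ?thesis
  proof (intro exI[of _ "20 ^ Suc k * C1 * C2"] conjI allI impI)
    show "20 ^ Suc k * C1 * C2 > 0" using C1 C2 by simp
    fix x :: real assume x: "x \<ge> 3"
    define m where "m = nat \<lfloor>log 2 x\<rfloor> - k"
    let ?Z = "\<lambda>i. level_set dyadic_primes (Suc k) (m + i)"
    let ?h = "\<lambda>i. 20 ^ Suc k * ((1 / 2) ^ (m + i) * harmonic_conv (Suc k) (m + i))"
    have sub: "{y. x \<le> block_prod (Suc k) y} \<subseteq> (\<Union>i. ?Z i)"
    proof
      fix y assume "y \<in> {y. x \<le> block_prod (Suc k) y}"
      then have y: "x \<le> block_prod (Suc k) y" by simp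
      then obtain n where n: "y \<in> level_set dyadic_primes (Suc k) n" "block_prod (Suc k) y < 2 ^ (n + Suc k)"
        using block_prod_in_level_set[of "Suc k" y] x by auto
      have "x < 2 ^ (n + Suc k)" using y n by linarith
      then have "log 2 x < log 2 (2 ^ (n + Suc k))" using x by (subst log_less_cancel_iff) auto
      also have "\<dots> = real (n + Suc k)" by (subst log_nat_power) auto
      finally have "\<lfloor>log 2 x\<rfloor> < int (n + Suc k)" by linarith
      then have "m \<le> n" unfolding m_def by linarith
      then show "y \<in> (\<Union>i. ?Z i)" using n by (auto intro!: exI[of _ "n - m"] simp del: level_set.simps)
    qed
    have Zle: "cfm 1 0 (?Z i) \<le> ?h i" for i
      using cfm_level_set_upper[of dyadic_primes 20 "1/2" 1 0 "Suc k" "m + i"]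
        finite_dyadic_primes sum_dyadic_primes_upper
      by (simp add: dyadic_primes_def mult.assoc del: level_set.simps harmonic_conv.simps)
    have sh: "summable ?h" by (intro summable_mult C1)
    have sZ: "summable (\<lambda>i. cfm 1 0 (?Z i))"
      using Zle by (intro summable_comparison_test[OF _ sh] exI[of _ 0]) auto
    have "cfm 1 0 {y. x \<le> block_prod (Suc k) y} \<le> cfm 1 0 (\<Union>i. ?Z i)"
      using sub by (intro cfm_mono) (auto simp del: level_set.simps)
    also have "\<dots> \<le> (\<Sum>i. cfm 1 0 (?Z i))"
      using sZ unfolding cfm_def by (intro finite_measure_subadditive_countably) (auto simp del: level_set.simps)
    also have "\<dots> \<le> (\<Sum>i. ?h i)" by (intro suminf_le Zle sZ sh)
    also have "\<dots> = 20 ^ Suc k * (\<Sum>i. (1 / 2) ^ (m + i) * harmonic_conv (Suc k) (m + i))"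
      by (rule suminf_mult[OF C1(2)])
    also have "\<dots> \<le> 20 ^ Suc k * (C1 * ((1 / 2) ^ m * harm (Suc m) ^ k / real (m + 1)))"
      by (intro mult_left_mono C1) auto
    also have "\<dots> \<le> 20 ^ Suc k * (C1 * (C2 * rate k x))"
      using C1 C2(2)[OF x] by (intro mult_left_mono) (auto simp: Let_def m_def)
    finally show "cfm 1 0 {y. x \<le> block_prod (Suc k) y} \<le> 20 ^ Suc k * C1 * C2 * rate k x"
      by (simp add: mult.assoc)
  qed
qed

text \<open>A single total level s with 16^s between x and a bounded multiple of x is enough: by
  geometric decay it already has the order of the whole tail.\<close>

lemma block_prod_tail_lower:
  "\<exists>c>0. \<forall>x\<ge>3. c * rate k x \<le> cfm 1 0 {y. x \<le> block_prod (Suc k) y}"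
proof -
  obtain b where b: "b > 0" "\<And>s. harmonic_conv (Suc k) s \<ge> b * harm (Suc s) ^ k / real (s + 1)"
    using harmonic_conv_lower[of k] by blast
  obtain c where c: "c > 0"
    "\<And>x. x \<ge> 3 \<Longrightarrow> \<exists>s. x \<le> 16 ^ s \<and> c * rate k x \<le> (1 / 16) ^ s * harm (Suc s) ^ k / real (s + 1)"
    using hexadic_rate_lower[of k] unfolding rate_def by metis
  define D :: real where "D = (1 / (12 * 16 ^ 3)) ^ Suc k"
  have D: "D > 0" by (simp add: D_def)
  show ?thesis
  proof (intro exI[of _ "D * b * c"] conjI allI impI)
    show "D * b * c > 0" using D b c by simp
    fix x :: real assume x: "x \<ge> 3"
    obtain s where s: "x \<le> 16 ^ s" "c * rate k x \<le> (1 / 16) ^ s * harm (Suc s) ^ k / real (s + 1)"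
      using c(2)[OF x] by blast
    have "D * b * c * rate k x = D * b * (c * rate k x)" by simp
    also have "\<dots> \<le> D * b * ((1 / 16) ^ s * harm (Suc s) ^ k / real (s + 1))"
      using D b s by (intro mult_left_mono) auto
    also have "\<dots> = D * (1 / 16) ^ s * (b * harm (Suc s) ^ k / real (s + 1))" by simp
    also have "\<dots> \<le> D * (1 / 16) ^ s * harmonic_conv (Suc k) s"
      using D by (intro mult_left_mono b) auto
    also have "\<dots> = D * (1 / 16) ^ s * harmonic_conv (Suc k) s * cfm 1 0 UNIV" by simp
    also have "\<dots> \<le> cfm 1 0 (level_set hexadic_primes (Suc k) s)"
      unfolding D_def
      by (intro cfm_level_set_lower finite_hexadic_primes hexadic_primes_disjoint sum_hexadic_primes_lower)
         (auto simp: hexadic_primes_def)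
    also have "\<dots> \<le> cfm 1 0 {y. x \<le> block_prod (Suc k) y}"
    proof (intro cfm_mono subsetI)
      fix y assume "y \<in> level_set hexadic_primes (Suc k) s"
      then show "y \<in> {y. x \<le> block_prod (Suc k) y}"
        using block_prod_ge_if_level_set[of y "Suc k" s] s by simp
    qed auto
    finally show "D * b * c * rate k x \<le> cfm 1 0 {y. x \<le> block_prod (Suc k) y}" .
  qed
qed

subsection \<open>Limsup sets\<close>

lemma cfm_funpow_le:
  assumes H: "H \<in> sets borel" and c: "c \<ge> 0"
    and le: "\<And>s t. s > 0 \<Longrightarrow> t \<ge> 0 \<Longrightarrow> t \<le> s \<Longrightarrow> cfm s t H \<le> c * cfm s t UNIV"
  shows "cfm 1 0 {x. (gauss_map ^^ m) x \<in> H} \<le> c"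
  using cfm_digits_then[OF assms, of 1 0 "\<lambda>_. True" m] by simp

text \<open>Induction from the earliest block onwards: the thresholds shift by one and the remaining
  blocks are read after l digits. Being uniform in s and t, the bound for the rest multiplies with
  the one for the first block.\<close>

lemma cfm_avoid_blocks:
  assumes st: "s > 0" "t \<ge> 0" "t \<le> s"
  shows "cfm s t {x. \<forall>j<N. \<not> u j \<le> block_prod l ((gauss_map ^^ (j * l)) x)}
    \<le> (\<Prod>j<N. 1 - cfm 1 0 {y. u j \<le> block_prod l y} / 4) * cfm s t UNIV"
  using st
proof (induction N arbitrary: u s t)
  case 0
  then show ?case by simp
next
  case (Suc N)
  interpret finite_measure "cf_measure s t" by (rule finite_measure_cf_measure[OF Suc.prems(1,2)])
  let ?F = "\<lambda>j. {y. u j \<le> block_prod l y}"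
  let ?H = "{x. \<forall>j<N. \<not> u (Suc j) \<le> block_prod l ((gauss_map ^^ (j * l)) x)}"
  let ?c = "\<Prod>j<N. 1 - cfm 1 0 (?F (Suc j)) / 4"
  have F: "?F j \<in> sets borel" for j by measurable
  have le1: "cfm 1 0 (?F j) \<le> 1" for j
    using cfm_mono[of 1 0 "?F j" UNIV] by simp
  have c: "?c \<ge> 0" using le1 by (intro prod_nonneg) (auto intro: order_trans[of _ 1])
  have "{x. \<forall>j<Suc N. \<not> u j \<le> block_prod l ((gauss_map ^^ (j * l)) x)}
      = {x. \<not> u 0 \<le> block_prod l x \<and> (gauss_map ^^ l) x \<in> ?H}"
    by (auto simp: All_less_Suc2 funpow_add add.commute[of l])
  then have "cfm s t {x. \<forall>j<Suc N. \<not> u j \<le> block_prod l ((gauss_map ^^ (j * l)) x)}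
      = cfm s t {x. \<not> u 0 \<le> prod_list (map (\<lambda>d. if prime d then real d else 0) (digits l x)) \<and> (gauss_map ^^ l) x \<in> ?H}"
    by (simp add: block_prod_eq_digits)
  \<comment> \<open>The past is the event that the first block is avoided, which depends on the
    first l digits only; the induction hypothesis is the uniform bound for what follows.\<close>
  also have "\<dots> \<le> ?c * cfm s t {x. \<not> u 0 \<le> prod_list (map (\<lambda>d. if prime d then real d else 0) (digits l x))}"
    using Suc.IH c Suc.prems by (intro cfm_digits_then) auto
  also have "{x. \<not> u 0 \<le> prod_list (map (\<lambda>d. if prime d then real d else 0) (digits l x))} = UNIV - ?F 0"
    by (auto simp: block_prod_eq_digits)
  also have "cfm s t (UNIV - ?F 0) = cfm s t UNIV - cfm s t (?F 0)"
    unfolding cfm_def using finite_measure_compl[of "?F 0"] F by simp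
  also have "?c * \<dots> \<le> ?c * (cfm s t UNIV - cfm 1 0 (?F 0) / 4 * cfm s t UNIV)"
    using cfm_distortion(2)[OF Suc.prems F[of 0]] c by (intro mult_left_mono) auto
  also have "\<dots> = (\<Prod>j<Suc N. 1 - cfm 1 0 (?F j) / 4) * cfm s t UNIV"
    by (simp add: prod.lessThan_Suc_shift algebra_simps del: prod.lessThan_Suc)
  finally show ?case .
qed

lemma prod_one_minus_le_exp:
  fixes v :: "nat \<Rightarrow> real"
  assumes "\<And>j. v j \<le> 1"
  shows "(\<Prod>j<N. 1 - v j) \<le> exp (- (\<Sum>j<N. v j))"
proof -
  have "(\<Prod>j<N. 1 - v j) \<le> (\<Prod>j<N. exp (- v j))"
    using assms exp_ge_add_one_self[of "- v _"] by (intro prod_mono) auto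
  also have "\<dots> = exp (- (\<Sum>j<N. v j))" by (simp add: exp_sum sum_negf[symmetric])
  finally show ?thesis .
qed

lemma cfm_avoid_all_blocks:
  assumes ns: "\<not> summable (\<lambda>j. cfm 1 0 {y. u j \<le> block_prod l y})"
  shows "cfm 1 0 {x. \<forall>j. \<not> u j \<le> block_prod l ((gauss_map ^^ (r + j * l)) x)} = 0"
proof (rule ccontr)
  let ?v = "\<lambda>j. cfm 1 0 {y. u j \<le> block_prod l y}"
  define d where "d = cfm 1 0 {x. \<forall>j. \<not> u j \<le> block_prod l ((gauss_map ^^ (r + j * l)) x)}"
  assume "\<not> ?thesis"
  then have d: "d > 0" using cfm_nonneg[of 1 0] by (simp add: d_def order_less_le)
  \<comment> \<open>Beyond this value of the partial sum, exp (- sum / 4) drops below d,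
    contradicting that d bounds the avoidance probability from below.\<close>
  have "\<not> (\<forall>N. (\<Sum>j<N. ?v j) \<le> - 4 * ln d)"
    using ns summableI_nonneg_bounded[of ?v "- 4 * ln d"] by auto
  then obtain N where N: "(\<Sum>j<N. ?v j) > - 4 * ln d" by (auto simp: not_le)
  let ?H = "{x. \<forall>j<N. \<not> u j \<le> block_prod l ((gauss_map ^^ (j * l)) x)}"
  let ?c = "\<Prod>j<N. 1 - ?v j / 4"
  have le1: "?v j / 4 \<le> 1" for j
    using cfm_mono[of 1 0 "{y. u j \<le> block_prod l y}" UNIV] by simp
  have H: "?H \<in> sets borel" by measurable
  have "d \<le> cfm 1 0 {x. (gauss_map ^^ r) x \<in> ?H}"
    unfolding d_def
  proof (intro cfm_mono)
    have "(gauss_map ^^ r) -` ?H \<in> sets borel"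
      using measurable_sets[OF measurable_gauss_map_funpow H] by simp
    then show "{x. (gauss_map ^^ r) x \<in> ?H} \<in> sets borel" by (simp add: vimage_def)
  qed (auto simp: funpow_add add.commute[of r])
  \<comment> \<open>The initial r digits are unconstrained; skipping them preserves the bound
    because it holds for all admissible s and t.\<close>
  also have "\<dots> \<le> ?c"
    using cfm_avoid_blocks H le1 by (intro cfm_funpow_le prod_nonneg) auto
  also have "\<dots> \<le> exp (- (\<Sum>j<N. ?v j / 4))" by (rule prod_one_minus_le_exp) (rule le1)
  also have "\<dots> < exp (ln d)" using N by (simp flip: sum_divide_distrib)
  also have "\<dots> = d" using d by simp
  finally show False by simp
qed

text \<open>Otherwise a partial sum, extended to n * l terms and regrouped by residues, would be
  bounded by the l finite sums together.\<close>

lemma not_summable_residue_class: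
  fixes v :: "nat \<Rightarrow> real"
  assumes ns: "\<not> summable v" and v: "\<And>n. v n \<ge> 0" and l: "l \<ge> 1"
  shows "\<exists>r. \<not> summable (\<lambda>j. v (r + j * l))"
proof (rule ccontr)
  assume "\<not> ?thesis"
  then have s: "summable (\<lambda>j. v (r + j * l))" for r by blast
  have "summable v"
  proof (rule summableI_nonneg_bounded[OF v])
    fix n
    have "n \<le> n * l" using l by simp
    then have "(\<Sum>i<n. v i) \<le> (\<Sum>i<n * l. v i)" using v by (intro sum_mono2) auto
    also have "\<dots> = (\<Sum>j<n. \<Sum>i\<in>{j * l..<j * l + l}. v i)" by (rule sum.nat_group[symmetric])
    also have "\<dots> = (\<Sum>j<n. \<Sum>r<l. v (r + j * l))"
    proof (rule sum.cong[OF refl])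
      fix j show "(\<Sum>i\<in>{j * l..<j * l + l}. v i) = (\<Sum>r<l. v (r + j * l))"
        using sum.shift_bounds_nat_ivl[of v 0 "j * l" l] by (simp add: atLeast0LessThan add.commute)
    qed
    also have "\<dots> = (\<Sum>r<l. \<Sum>j<n. v (r + j * l))" by (rule sum.swap)
    also have "\<dots> \<le> (\<Sum>r<l. \<Sum>j. v (r + j * l))"
      using v s by (intro sum_mono sum_le_suminf) auto
    finally show "(\<Sum>i<n. v i) \<le> (\<Sum>r<l. \<Sum>j. v (r + j * l))" .
  qed
  then show False using ns by simp
qed

section \<open>The limsup set and its measure\<close>

lemma emeasure_lborel_eq_cf_measure:
  assumes A: "A \<in> sets borel"
  shows "emeasure lborel ({0..<1} \<inter> A) = emeasure (cf_measure 1 0) A"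
proof -
  have "emeasure lborel ({0..<1} \<inter> A) = emeasure lborel (A \<inter> {0<..<1})"
    using AE_lborel_singleton[of "0::real"]
    by (intro emeasure_eq_AE) (use A in \<open>auto elim!: eventually_mono\<close>)
  then show ?thesis using emeasure_cf_measure_1_0[OF A] by simp
qed

definition block_limsup :: "nat \<Rightarrow> (nat \<Rightarrow> real) \<Rightarrow> real set" where
  "block_limsup l \<psi> = {x. \<exists>\<^sub>\<infinity> n. \<psi> n \<le> block_prod l ((gauss_map ^^ n) x)}"

lemma sets_block_limsup [measurable]: "block_limsup l \<psi> \<in> sets borel"
  unfolding block_limsup_def INFM_nat by measurable

text \<open>Digits are numbered from 1, iterates from 0: the block starting at digit n + 1 is the
  initial block of the iterate of order n, hence the shifted threshold. This reindexing also takes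
  care of the condition n \<ge> 1.\<close>

lemma E_prime_eq_block_limsup: "E_prime l \<phi> = {0..<1} \<inter> block_limsup l (\<lambda>n. \<phi> (Suc n))"
proof -
  have prod: "(\<Prod>k\<in>{Suc n..<Suc n + l}. real (cf_prime_digit k x)) = block_prod l ((gauss_map ^^ n) x)" for n x
  proof -
    have "(\<Prod>k\<in>{Suc n..<Suc n + l}. real (cf_prime_digit k x)) = (\<Prod>i<l. real (cf_prime_digit (i + Suc n) x))"
      using prod.shift_bounds_nat_ivl[of "\<lambda>k. real (cf_prime_digit k x)" 0 "Suc n" l]
      by (simp add: atLeast0LessThan add.commute)
    also have "\<dots> = block_prod l ((gauss_map ^^ n) x)"
      unfolding block_prod_def
      by (intro prod.cong refl)
         (simp add: cf_prime_digit_def cf_digit_eq_first_digit first_prime_digit_def funpow_add)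
    finally show ?thesis .
  qed
  have "(\<exists>\<^sub>\<infinity> n. n \<ge> 1 \<and> (\<Prod>k\<in>{n..<n+l}. real (cf_prime_digit k x)) \<ge> \<phi> n) \<longleftrightarrow>
      (\<exists>\<^sub>\<infinity> n. \<phi> (Suc n) \<le> block_prod l ((gauss_map ^^ n) x))" for x
    unfolding cofinite_eq_sequentially frequently_def
    by (subst eventually_sequentially_Suc[symmetric]) (simp add: prod del: add_Suc)
  then show ?thesis by (auto simp: E_prime_def block_limsup_def)
qed

lemma block_limsup_null:
  assumes sm: "summable (\<lambda>n. cfm 1 0 {y. \<psi> n \<le> block_prod l y})"
  shows "emeasure (cf_measure 1 0) (block_limsup l \<psi>) = 0"
proof -
  interpret finite_measure "cf_measure 1 0" by (rule finite_measure_cf_measure) auto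
  let ?F = "\<lambda>n. {y. \<psi> n \<le> block_prod l y}"
  let ?A = "\<lambda>n. {x. (gauss_map ^^ n) x \<in> ?F n}"
  have F: "?F n \<in> sets borel" for n by measurable
  have A: "?A n \<in> sets (cf_measure 1 0)" for n by measurable
  \<comment> \<open>Lebesgue measure is not invariant under the Gauss map; pulling the event back
    along n iterations costs the factor 4 of the distortion bound.\<close>
  have "cfm 1 0 (?A n) \<le> 4 * cfm 1 0 (?F n)" for n
    using cfm_distortion(1) F by (intro cfm_funpow_le) auto
  then have "summable (\<lambda>n. measure (cf_measure 1 0) (?A n))"
    by (intro summable_comparison_test[OF _ summable_mult[OF sm, of 4]] exI[of _ 0]) (auto simp: cfm_def)
  then have "AE x in cf_measure 1 0. eventually (\<lambda>n. x \<in> space (cf_measure 1 0) - ?A n) sequentially"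
    using A by (intro borel_cantelli_AE1) (auto simp: emeasure_eq_measure)
  then have "AE x in cf_measure 1 0. \<not> x \<in> block_limsup l \<psi>"
    by (rule eventually_mono)
       (simp add: block_limsup_def frequently_def cofinite_eq_sequentially)
  then have "emeasure (cf_measure 1 0) {x \<in> space (cf_measure 1 0). x \<in> block_limsup l \<psi>} = 0"
    by (rule emeasure_eq_0_AE)
  then show ?thesis by simp
qed

lemma block_limsup_full:
  assumes ns: "\<not> summable (\<lambda>n. cfm 1 0 {y. \<psi> n \<le> block_prod l y})" and l: "l \<ge> 1"
  shows "emeasure (cf_measure 1 0) (block_limsup l \<psi>) = 1"
proof -
  obtain r where r: "\<not> summable (\<lambda>j. cfm 1 0 {y. \<psi> (r + j * l) \<le> block_prod l y})"
    using not_summable_residue_class[OF ns _ l] by auto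
  \<comment> \<open>\<open>?G M\<close> avoids all blocks from the M-th on. Dropping M terms leaves
    the series divergent, so each \<open>?G M\<close> is null; outside their countable union every M
    is followed by a hit, which gives infinitely many.\<close>
  let ?G = "\<lambda>M. {x. \<forall>j. \<not> \<psi> (r + (j + M) * l) \<le> block_prod l ((gauss_map ^^ ((r + M * l) + j * l)) x)}"
  have G: "?G M \<in> null_sets (cf_measure 1 0)" for M
  proof -
    have "\<not> summable (\<lambda>j. cfm 1 0 {y. \<psi> (r + (j + M) * l) \<le> block_prod l y})"
      using r summable_iff_shift[of "\<lambda>j. cfm 1 0 {y. \<psi> (r + j * l) \<le> block_prod l y}" M] by simp
    then have "cfm 1 0 (?G M) = 0" by (rule cfm_avoid_all_blocks)
    moreover have "?G M \<in> sets borel" by measurable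
    ultimately show ?thesis by (simp add: null_sets_def emeasure_eq_cfm)
  qed
  have "AE x in cf_measure 1 0. \<forall>M. x \<notin> ?G M"
    unfolding AE_all_countable using G by (intro allI AE_not_in)
  then have "AE x in cf_measure 1 0. x \<in> block_limsup l \<psi>"
  proof (rule eventually_mono)
    fix x assume x: "\<forall>M. x \<notin> ?G M"
    show "x \<in> block_limsup l \<psi>"
      unfolding block_limsup_def INFM_nat_le mem_Collect_eq
    proof
      fix M
      obtain j where "\<psi> (r + (j + M) * l) \<le> block_prod l ((gauss_map ^^ ((r + M * l) + j * l)) x)"
        using x[rule_format, of M] by auto
      moreover have "(r + M * l) + j * l = r + (j + M) * l" by (simp add: algebra_simps)
      moreover have "M \<le> r + (j + M) * l"
      proof -
        have "M * 1 \<le> (j + M) * l" using l by (intro mult_le_mono) auto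
        then show ?thesis by linarith
      qed
      ultimately show "\<exists>n\<ge>M. \<psi> n \<le> block_prod l ((gauss_map ^^ n) x)" by metis
    qed
  qed
  then have "emeasure (cf_measure 1 0) (block_limsup l \<psi>) = emeasure (cf_measure 1 0) UNIV"
    by (intro emeasure_eq_AE) (auto elim!: eventually_mono)
  then show ?thesis by (simp add: emeasure_cf_measure_1_0)
qed

theorem theorem1p8:
  fixes l :: nat and \<phi> :: "nat \<Rightarrow> real"
  assumes "l \<ge> 1"
    and "\<And>n. n \<ge> 1 \<Longrightarrow> \<phi> n \<ge> 3"
  shows "(summable (\<lambda>n. (ln (ln (\<phi> (Suc n)))) ^ (l - 1) / (\<phi> (Suc n) * ln (\<phi> (Suc n))))
            \<longrightarrow> E_prime l \<phi> \<in> sets lborel \<and> emeasure lborel (E_prime l \<phi>) = 0)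
       \<and> (\<not> summable (\<lambda>n. (ln (ln (\<phi> (Suc n)))) ^ (l - 1) / (\<phi> (Suc n) * ln (\<phi> (Suc n))))
            \<longrightarrow> E_prime l \<phi> \<in> sets lborel \<and> emeasure lborel (E_prime l \<phi>) = 1)"
proof -
  obtain k where k: "l = Suc k" using assms(1) by (cases l) auto
  let ?\<psi> = "\<lambda>n. \<phi> (Suc n)"
  let ?v = "\<lambda>n. cfm 1 0 {y. ?\<psi> n \<le> block_prod l y}"
  have \<psi>: "?\<psi> n \<ge> 3" for n using assms(2) by simp
  have nonneg: "rate k (?\<psi> n) \<ge> 0" for n
    using ln_ge_1_if_ge_3[OF \<psi>[of n]] \<psi>[of n] by (simp add: rate_def)
  obtain C where C: "C > 0" "\<And>n. ?v n \<le> C * rate k (?\<psi> n)"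
    using block_prod_tail_upper[of k] \<psi> unfolding k by blast
  obtain c where c: "c > 0" "\<And>n. c * rate k (?\<psi> n) \<le> ?v n"
    using block_prod_tail_lower[of k] \<psi> unfolding k by blast
  have rate: "(\<lambda>n. (ln (ln (\<phi> (Suc n)))) ^ (l - 1) / (\<phi> (Suc n) * ln (\<phi> (Suc n)))) = (\<lambda>n. rate k (?\<psi> n))"
    by (simp add: rate_def k)
  have sets: "E_prime l \<phi> \<in> sets lborel"
    unfolding E_prime_eq_block_limsup by measurable
  have meas: "emeasure lborel (E_prime l \<phi>) = emeasure (cf_measure 1 0) (block_limsup l ?\<psi>)"
    unfolding E_prime_eq_block_limsup by (rule emeasure_lborel_eq_cf_measure) measurable
  \<comment> \<open>The two tail bounds at x = \<phi>(n+1) make the given series and that of the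
    tail probabilities converge or diverge together.\<close>
  have "summable ?v" if "summable (\<lambda>n. rate k (?\<psi> n))"
    using C(2) by (intro summable_comparison_test[OF _ summable_mult[OF that, of C]] exI[of _ 0]) auto
  moreover have "summable (\<lambda>n. rate k (?\<psi> n))" if "summable ?v"
  proof -
    have "summable (\<lambda>n. c * rate k (?\<psi> n))"
      using c nonneg by (intro summable_comparison_test[OF _ that] exI[of _ 0]) auto
    then show ?thesis using c(1) by (simp add: summable_cmult_iff)
  qed
  ultimately have iff: "summable (\<lambda>n. rate k (?\<psi> n)) \<longleftrightarrow> summable ?v" by (rule iffI)
  show ?thesis
    unfolding rate meas iff
  proof (intro conjI impI sets)
    show "emeasure (cf_measure 1 0) (block_limsup l ?\<psi>) = 0" if "summable ?v"
      using that by (rule block_limsup_null)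
    show "emeasure (cf_measure 1 0) (block_limsup l ?\<psi>) = 1" if "\<not> summable ?v"
      using that assms(1) by (rule block_limsup_full)
  qed
qed

end
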